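(* Let $n\ge 2$, let $\sigma\in VT_n/\Gamma_2(PVT_n)$, let $\theta=\overline{\pi}(\sigma)^{-1}$ and let $T_\theta$ be a transversal of the action of $\sigma$ on $\{\lambda_{i,j}\mid 1\le i<j\le n\}$. Let $a_{i,j}\in\mathbb{Z}$ for $1\le i<j\le n$ and $b_{r,s}\in\mathbb{Z}$ for $\lambda_{r,s}\in T_\theta$. The elements $\prod_{1\le i<j\le n}\lambda_{i,j}^{a_{i,j}}\,\sigma$ and $\prod_{\lambda_{r,s}\in T_\theta}\lambda_{r,s}^{b_{r,s}}\,\sigma$ are conjugate in $VT_n/\Gamma_2(PVT_n)$ if for all $\lambda_{r,s}\in T_\theta$ the following holds: - if $\mathcal{O}_\theta(\lambda_{r,s})$ is not of the form $\{\lambda_{r,s},\lambda_{r,s}^{-1},\dots,\lambda_{r_l,s_l},\lambda_{r_l,s_l}^{-1}\}$ (i.e. it does not contain $\lambda_{r,s}^{-1}$), then $$b_{r,s}=a_{r,s}+(-1)^{k_{r_1,s_1}}a_{r_1,s_1}+\cdots+(-1)^{k_{r_k,s_k}}a_{r_k,s_k},$$ where $(r_i,s_i)=(\theta^i(r),\theta^i(s))$ and $\lambda_{r,s},\lambda_{r_1,s_1},\dots,\lambda_{r_k,s_k}$ are the distinct elements of $\mathcal{O}_\theta(\lambda_{r,s})$; - if $\mathcal{O}_\theta(\lambda_{r,s})=\{\lambda_{r,s},\lambda_{r,s}^{-1},\dots,\lambda_{r_l,s_l},\lambda_{r_l,s_l}^{-1}\}$, then $$b_{r,s}=a_{r,s}-a_{\theta(r),\theta(s)}-\cdots-a_{\theta^q(r),\theta^q(s)},\qquad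 q=\frac{|\mathcal{O}_\theta(\lambda_{r,s})|}{2}-1 .$$ Here $k_{\theta^i(r),\theta^i(s)}=0$ if $\theta^i(r)<\theta^i(s)$, and $k_{\theta^i(r),\theta^i(s)}=1$ with $a_{\theta^i(r),\theta^i(s)}:=a_{\theta^i(s),\theta^i(r)}$ if $\theta^i(s)<\theta^i(r)$.
   Context: Permutations are composed left to right: $\sigma\tau(x)=\tau(\sigma(x))$. $\Gamma_2(H)=[H,H]$. The virtual twin group $VT_n$ is the group with generators $\sigma_i,\rho_i$ ($1\le i\le n-1$) and relations: $\sigma_i^2=1$, $\rho_i^2=1$; $\sigma_i\sigma_j=\sigma_j\sigma_i$, $\rho_i\rho_j=\rho_j\rho_i$, $\rho_i\sigma_j=\sigma_j\rho_i$ for $|i-j|\ge 2$; $\rho_i\rho_{i+1}\rho_i=\rho_{i+1}\rho_i\rho_{i+1}$ and $\rho_i\rho_{i+1}\sigma_i=\sigma_{i+1}\rho_i\rho_{i+1}$ for $1\le i\le n-2$. $PVT_n$ is the kernel of $\pi\colon VT_n\to S_n$, $\sigma_i,\rho_i\mapsto(i,i+1)$, and $\overline{\pi}\colon VT_n/\Gamma_2(PVT_n)\to S_n$ is the induced map. Put $\lambda_{i,i+1}=\sigma_i\rho_i$, $\lambda_{i,j}=w\lambda_{i,i+1}w^{-1}$ with $w=\rho_{j-1}\rho_{j-2}\cdots\rho_{i+1}$ for $j>i+1$, and $\lambda_{j,i}=\lambda_{i,j}^{-1}$ for $i<j$. It is known that $PVT_n/\Gamma_2(PVT_n)$ is free Abelian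 with basis $\{\lambda_{i,j}\mid 1\le i<j\le n\}$ and that $\nu\lambda_{i,j}\nu^{-1}=\lambda_{\theta(i),\theta(j)}$ for $\nu\in VT_n/\Gamma_2(PVT_n)$, $\theta=\overline{\pi}(\nu)^{-1}$; thus $\nu$ permutes the $\lambda_{i,j}$ up to inversion. $\mathcal{O}_\theta(\lambda_{r,s})=\{\lambda_{\theta^k(r),\theta^k(s)}\mid k\in\mathbb{Z}\}$ (which may contain inverses of basis elements), and a transversal $T_\theta\subseteq\{\lambda_{i,j}\mid i<j\}$ contains exactly one $\lambda_{r,s}$, $r<s$, for each orbit of $\langle\theta\rangle$ on unordered pairs $\{r,s\}$. *)

theory Defs
  imports "HOL-Algebra.Sym_Groups" "HOL-Algebra.FiniteProduct"
begin

section \<open>Groups given by generators and relations\<close>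

text \<open>A letter \<open>(g, True)\<close> stands for the generator \<open>g\<close>, and \<open>(g, False)\<close> for its inverse.
  Each pair \<open>(u, v)\<close> in the set of relations stands for the relation \<open>u = v\<close>.\<close>

type_synonym 'g gword = "('g \<times> bool) list"

inductive word_cong :: "'g set \<Rightarrow> ('g gword \<times> 'g gword) set \<Rightarrow> 'g gword \<Rightarrow> 'g gword \<Rightarrow> bool"
  for S R where
  refl: "w \<in> lists (S \<times> UNIV) \<Longrightarrow> word_cong S R w w"
| sym: "word_cong S R u v \<Longrightarrow> word_cong S R v u"
| trans: "word_cong S R u v \<Longrightarrow> word_cong S R v w \<Longrightarrow> word_cong S R u w"
| append: "word_cong S R u u' \<Longrightarrow> word_cong S R v v' \<Longrightarrow> word_cong S R (u @ v) (u' @ v')"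
| cancel: "g \<in> S \<Longrightarrow> word_cong S R [(g, e), (g, \<not> e)] []"
| relation: "(u, v) \<in> R \<Longrightarrow> word_cong S R u v"

definition word_rel :: "'g set \<Rightarrow> ('g gword \<times> 'g gword) set \<Rightarrow> ('g gword \<times> 'g gword) set" where
  "word_rel S R = {(u, v). word_cong S R u v}"

definition word_class :: "'g set \<Rightarrow> ('g gword \<times> 'g gword) set \<Rightarrow> 'g gword \<Rightarrow> 'g gword set" where
  "word_class S R w = word_rel S R `` {w}"

definition presented_group :: "'g set \<Rightarrow> ('g gword \<times> 'g gword) set \<Rightarrow> 'g gword set monoid" where
  "presented_group S R =
    \<lparr> carrier = lists (S \<times> UNIV) // word_rel S R,
      mult = (\<lambda>X Y. \<Union>u\<in>X. \<Union>v\<in>Y. word_class S R (u @ v)),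
      one = word_class S R [] \<rparr>"

fun word_eval :: "('a, 'b) monoid_scheme \<Rightarrow> ('g \<Rightarrow> 'a) \<Rightarrow> 'g gword \<Rightarrow> 'a" where
  "word_eval H f [] = \<one>\<^bsub>H\<^esub>"
| "word_eval H f ((g, e) # w) = (if e then f g else inv\<^bsub>H\<^esub> (f g)) \<otimes>\<^bsub>H\<^esub> word_eval H f w"

text \<open>The homomorphism out of a presented group that extends a map \<open>f\<close> on the generators;
  it is well defined when \<open>f\<close> respects the relations (see \<open>presented_lift_class\<close> below).\<close>

definition presented_lift ::
    "('a, 'b) monoid_scheme \<Rightarrow> ('g \<Rightarrow> 'a) \<Rightarrow> 'g gword set \<Rightarrow> 'a" where
  "presented_lift H f X = the_elem (word_eval H f ` X)"

lemma word_cong_lists: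
  assumes "R \<subseteq> lists (S \<times> UNIV) \<times> lists (S \<times> UNIV)" "word_cong S R u v"
  shows "u \<in> lists (S \<times> UNIV) \<and> v \<in> lists (S \<times> UNIV)"
  using assms(2,1) by induction auto

lemma equiv_word_rel:
  assumes "R \<subseteq> lists (S \<times> UNIV) \<times> lists (S \<times> UNIV)"
  shows "equiv (lists (S \<times> UNIV)) (word_rel S R)"
proof (rule equivI)
  show "word_rel S R \<subseteq> lists (S \<times> UNIV) \<times> lists (S \<times> UNIV)"
    using word_cong_lists[OF assms] unfolding word_rel_def by blast
  show "refl_on (lists (S \<times> UNIV)) (word_rel S R)"
    by (rule refl_onI) (auto simp: word_rel_def intro: word_cong.refl)
  show "Relation.sym (word_rel S R)"
    by (rule symI) (auto simp: word_rel_def intro: word_cong.sym)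
  show "Relation.trans (word_rel S R)"
    by (rule transI) (auto simp: word_rel_def intro: word_cong.trans)
qed

lemma word_class_eq_iff:
  assumes "R \<subseteq> lists (S \<times> UNIV) \<times> lists (S \<times> UNIV)"
    and "u \<in> lists (S \<times> UNIV)" "v \<in> lists (S \<times> UNIV)"
  shows "word_class S R u = word_class S R v \<longleftrightarrow> word_cong S R u v"
  using eq_equiv_class_iff[OF equiv_word_rel[OF assms(1)] assms(2,3)]
  by (simp add: word_class_def word_rel_def)

lemma presented_mult_class:
  assumes R: "R \<subseteq> lists (S \<times> UNIV) \<times> lists (S \<times> UNIV)"
    and u: "u \<in> lists (S \<times> UNIV)" and v: "v \<in> lists (S \<times> UNIV)"
  shows "word_class S R u \<otimes>\<^bsub>presented_group S R\<^esub> word_class S R v = word_class S R (u @ v)"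
proof -
  have "word_class S R (u' @ v') = word_class S R (u @ v)"
    if "word_cong S R u u'" "word_cong S R v v'" for u' v'
    using that word_cong_lists[OF R] word_class_eq_iff[OF R]
    by (meson append_in_lists_conv word_cong.append word_cong.sym)
  moreover have "word_cong S R u u" "word_cong S R v v"
    using u v by (auto intro: word_cong.refl)
  ultimately have "(\<Union>u'\<in>word_class S R u. \<Union>v'\<in>word_class S R v. word_class S R (u' @ v'))
      = word_class S R (u @ v)"
    unfolding word_class_def word_rel_def by blast
  then show ?thesis by (simp add: presented_group_def)
qed

lemma presented_group_carrier:
  "carrier (presented_group S R) = word_class S R ` lists (S \<times> UNIV)"
  by (auto simp: presented_group_def quotient_def word_class_def)

lemma inverse_word_lists:
  assumes "w \<in> lists (S \<times> UNIV)"
  shows "rev (map (\<lambda>(g, e). (g, \<not> e)) w) \<in> lists (S \<times> UNIV)"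
  using assms by induction auto

lemma word_cong_inverse:
  assumes "w \<in> lists (S \<times> UNIV)"
  shows "word_cong S R (rev (map (\<lambda>(g, e). (g, \<not> e)) w) @ w) []"
  using assms
proof (induction w)
  case Nil
  then show ?case by (simp add: word_cong.refl)
next
  case (Cons x w)
  obtain g e where x: "x = (g, e)" by (cases x)
  let ?w' = "rev (map (\<lambda>(g, e). (g, \<not> e)) w)"
  have w: "w \<in> lists (S \<times> UNIV)" and g: "g \<in> S" using Cons.hyps x by auto
  have w': "?w' \<in> lists (S \<times> UNIV)" using w by (rule inverse_word_lists)
  have "word_cong S R ([(g, \<not> e), (g, e)] @ w) ([] @ w)"
    using word_cong.cancel[OF g, of R "\<not> e"] word_cong.refl[OF w]
    by (intro word_cong.append) simp_all
  then have "word_cong S R (?w' @ [(g, \<not> e), (g, e)] @ w) (?w' @ w)"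
    using word_cong.append[OF word_cong.refl[OF w']] by fastforce
  then have "word_cong S R (?w' @ [(g, \<not> e), (g, e)] @ w) []"
    using Cons.IH by (rule word_cong.trans)
  then show ?case by (simp add: x)
qed

lemma group_presented_group:
  assumes R: "R \<subseteq> lists (S \<times> UNIV) \<times> lists (S \<times> UNIV)"
  shows "group (presented_group S R)"
proof (rule groupI)
  let ?G = "presented_group S R"
  have one: "\<one>\<^bsub>?G\<^esub> = word_class S R []" by (simp add: presented_group_def)
  show "\<one>\<^bsub>?G\<^esub> \<in> carrier ?G" by (auto simp: one presented_group_carrier)
  fix x assume "x \<in> carrier ?G"
  then obtain u where u: "u \<in> lists (S \<times> UNIV)" "x = word_class S R u"
    by (auto simp: presented_group_carrier)
  show "\<one>\<^bsub>?G\<^esub> \<otimes>\<^bsub>?G\<^esub> x = x"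
    using presented_mult_class[OF R _ u(1), of "[]"] by (simp add: one u(2))
  show "\<exists>y\<in>carrier ?G. y \<otimes>\<^bsub>?G\<^esub> x = \<one>\<^bsub>?G\<^esub>"
  proof (intro bexI)
    let ?u' = "rev (map (\<lambda>(g, e). (g, \<not> e)) u)"
    have u': "?u' \<in> lists (S \<times> UNIV)" using u(1) by (rule inverse_word_lists)
    show "word_class S R ?u' \<in> carrier ?G" using u' unfolding presented_group_carrier by (rule imageI)
    have "word_class S R (?u' @ u) = word_class S R []"
      using word_cong_inverse[OF u(1)] word_class_eq_iff[OF R] word_cong_lists[OF R] by blast
    then show "word_class S R ?u' \<otimes>\<^bsub>?G\<^esub> x = \<one>\<^bsub>?G\<^esub>"
      using presented_mult_class[OF R u' u(1)] by (simp add: one u(2))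
  qed
  fix y assume "y \<in> carrier ?G"
  then obtain v where v: "v \<in> lists (S \<times> UNIV)" "y = word_class S R v"
    by (auto simp: presented_group_carrier)
  have uv: "u @ v \<in> lists (S \<times> UNIV)" using u v by simp
  show "x \<otimes>\<^bsub>?G\<^esub> y \<in> carrier ?G"
    unfolding u(2) v(2) presented_mult_class[OF R u(1) v(1)] presented_group_carrier
    using uv by (rule imageI)
  fix z assume "z \<in> carrier ?G"
  then obtain w where w: "w \<in> lists (S \<times> UNIV)" "z = word_class S R w"
    by (auto simp: presented_group_carrier)
  have vw: "v @ w \<in> lists (S \<times> UNIV)" using v w by simp
  show "x \<otimes>\<^bsub>?G\<^esub> y \<otimes>\<^bsub>?G\<^esub> z = x \<otimes>\<^bsub>?G\<^esub> (y \<otimes>\<^bsub>?G\<^esub> z)"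
    unfolding u(2) v(2) w(2) presented_mult_class[OF R u(1) v(1)] presented_mult_class[OF R v(1) w(1)]
      presented_mult_class[OF R uv w(1)] presented_mult_class[OF R u(1) vw] by simp
qed

lemma (in group) word_eval_closed:
  assumes "f \<in> S \<rightarrow> carrier G" "w \<in> lists (S \<times> UNIV)"
  shows "word_eval G f w \<in> carrier G"
  using assms(2,1) by induction (auto simp: Pi_iff)

lemma (in group) word_eval_append:
  assumes "f \<in> S \<rightarrow> carrier G" "u \<in> lists (S \<times> UNIV)" "v \<in> lists (S \<times> UNIV)"
  shows "word_eval G f (u @ v) = word_eval G f u \<otimes> word_eval G f v"
  using assms(2)
proof induction
  case Nil
  show ?case using word_eval_closed[OF assms(1,3)] by simp
next
  case (Cons x u)
  obtain g e where x: "x = (g, e)" by (cases x)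
  have "f g \<in> carrier G" using Cons.hyps x assms(1) by auto
  moreover have "word_eval G f u \<in> carrier G" "word_eval G f v \<in> carrier G"
    using Cons.hyps word_eval_closed[OF assms(1)] assms(3) by auto
  ultimately show ?case using Cons.IH by (simp add: x m_assoc)
qed

lemma (in group) presented_lift_class:
  assumes R: "R \<subseteq> lists (S \<times> UNIV) \<times> lists (S \<times> UNIV)" and f: "f \<in> S \<rightarrow> carrier G"
    and rel: "\<And>u v. (u, v) \<in> R \<Longrightarrow> word_eval G f u = word_eval G f v"
    and w: "w \<in> lists (S \<times> UNIV)"
  shows "presented_lift G f (word_class S R w) = word_eval G f w"
proof -
  have *: "word_eval G f u = word_eval G f v" if "word_cong S R u v" for u v
    using that
  proof induction
    case (append u u' v v')
    then show ?case
      using word_cong_lists[OF R] word_eval_append[OF f] by metis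
  next
    case (cancel g e)
    then have "f g \<in> carrier G" using f by auto
    then show ?case by (cases e) auto
  next
    case (relation u v)
    then show ?case by (rule rel)
  next
    case (refl w)
    show ?case ..
  next
    case (sym u v)
    from sym.IH show ?case ..
  next
    case (trans u v w)
    from trans.IH show ?case by (rule HOL.trans)
  qed
  have "w \<in> word_class S R w"
    using word_cong.refl[OF w] by (simp add: word_class_def word_rel_def)
  moreover have "word_eval G f u = word_eval G f w" if "u \<in> word_class S R w" for u
    using *[of w u] that by (simp add: word_class_def word_rel_def)
  ultimately have "word_eval G f ` word_class S R w = {word_eval G f w}"
    by blast
  then show ?thesis by (simp add: presented_lift_def)
qed

section \<open>The virtual twin group and its quotient\<close>

datatype vgen = Sig nat | Rho nat

definition vt_gens :: "nat \<Rightarrow> vgen set" where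
  "vt_gens n = Sig ` {1..n-1} \<union> Rho ` {1..n-1}"

definition pos_word :: "'g list \<Rightarrow> 'g gword" where
  "pos_word gs = map (\<lambda>g. (g, True)) gs"

definition vt_rels :: "nat \<Rightarrow> (vgen gword \<times> vgen gword) set" where
  "vt_rels n = map_prod pos_word pos_word `
    ( {([Sig i, Sig i], []) | i. i \<in> {1..n-1}}
    \<union> {([Rho i, Rho i], []) | i. i \<in> {1..n-1}}
    \<union> {([Sig i, Sig j], [Sig j, Sig i]) | i j.
          i \<in> {1..n-1} \<and> j \<in> {1..n-1} \<and> \<bar>int i - int j\<bar> \<ge> 2}
    \<union> {([Rho i, Rho j], [Rho j, Rho i]) | i j.
          i \<in> {1..n-1} \<and> j \<in> {1..n-1} \<and> \<bar>int i - int j\<bar> \<ge> 2}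
    \<union> {([Rho i, Sig j], [Sig j, Rho i]) | i j.
          i \<in> {1..n-1} \<and> j \<in> {1..n-1} \<and> \<bar>int i - int j\<bar> \<ge> 2}
    \<union> {([Rho i, Rho (i+1), Rho i], [Rho (i+1), Rho i, Rho (i+1)]) | i. i \<in> {1..n-2}}
    \<union> {([Rho i, Rho (i+1), Sig i], [Sig (i+1), Rho i, Rho (i+1)]) | i. i \<in> {1..n-2}} )"

definition VT :: "nat \<Rightarrow> vgen gword set monoid" where
  "VT n = presented_group (vt_gens n) (vt_rels n)"

definition vt_word :: "nat \<Rightarrow> vgen list \<Rightarrow> vgen gword set" where
  "vt_word n gs = word_class (vt_gens n) (vt_rels n) (pos_word gs)"

text \<open>The symmetric group with permutations composed from left to right, so that the product
  of \<open>p\<close> and \<open>q\<close> maps \<open>x\<close> to \<open>q (p x)\<close>; the library's \<open>sym_group\<close> composes from right to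
  left.\<close>

definition Sn :: "nat \<Rightarrow> (nat \<Rightarrow> nat) monoid" where
  "Sn n = (sym_group n)\<lparr>mult := (\<lambda>p q. q \<circ> p)\<rparr>"

fun gen_perm :: "vgen \<Rightarrow> nat \<Rightarrow> nat" where
  "gen_perm (Sig i) = transpose i (i+1)"
| "gen_perm (Rho i) = transpose i (i+1)"

definition vt_pi :: "nat \<Rightarrow> vgen gword set \<Rightarrow> nat \<Rightarrow> nat" where
  "vt_pi n = presented_lift (Sn n) gen_perm"

definition PVT :: "nat \<Rightarrow> vgen gword set set" where
  "PVT n = kernel (VT n) (Sn n) (vt_pi n)"

definition Gamma2_PVT :: "nat \<Rightarrow> vgen gword set set" where
  "Gamma2_PVT n = derived (VT n) (PVT n)"

definition VTQ :: "nat \<Rightarrow> vgen gword set set monoid" where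
  "VTQ n = VT n Mod Gamma2_PVT n"

definition PVTQ :: "nat \<Rightarrow> vgen gword set set monoid" where
  "PVTQ n = (VT n\<lparr>carrier := PVT n\<rparr>) Mod Gamma2_PVT n"

definition vt_pi_bar :: "nat \<Rightarrow> vgen gword set set \<Rightarrow> nat \<Rightarrow> nat" where
  "vt_pi_bar n X = the_elem (vt_pi n ` X)"

section \<open>The elements \<open>\<lambda>\<^bsub>i,j\<^esub>\<close>, orbits and transversals\<close>

text \<open>\<open>lam_pos\<close> is only meaningful for \<open>i < j\<close>, and \<open>lam\<close> for \<open>i \<noteq> j\<close>. When \<open>j = i + 1\<close> the
  conjugating word is empty.\<close>

definition lam_pos :: "nat \<Rightarrow> nat \<Rightarrow> nat \<Rightarrow> vgen gword set" where
  "lam_pos n i j =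
    (let w = vt_word n (map Rho (rev [i+1..<j]))
     in w \<otimes>\<^bsub>VT n\<^esub> vt_word n [Sig i, Rho i] \<otimes>\<^bsub>VT n\<^esub> inv\<^bsub>VT n\<^esub> w)"

definition lam_VT :: "nat \<Rightarrow> nat \<Rightarrow> nat \<Rightarrow> vgen gword set" where
  "lam_VT n i j = (if i < j then lam_pos n i j else inv\<^bsub>VT n\<^esub> (lam_pos n j i))"

definition lam :: "nat \<Rightarrow> nat \<Rightarrow> nat \<Rightarrow> vgen gword set set" where
  "lam n i j = Gamma2_PVT n #>\<^bsub>VT n\<^esub> lam_VT n i j"

definition pairs :: "nat \<Rightarrow> (nat \<times> nat) set" where
  "pairs n = {(i, j). 1 \<le> i \<and> i < j \<and> j \<le> n}"

text \<open>Products of powers of the \<open>\<lambda>\<^bsub>i,j\<^esub>\<close> are taken in the commutative group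
  \<open>PVT\<^sub>n / \<Gamma>\<^sub>2(PVT\<^sub>n)\<close>, whose operation is that of \<open>VT\<^sub>n / \<Gamma>\<^sub>2(PVT\<^sub>n)\<close>.\<close>

definition lam_prod :: "nat \<Rightarrow> (nat \<times> nat) set \<Rightarrow> (nat \<Rightarrow> nat \<Rightarrow> int) \<Rightarrow> vgen gword set set" where
  "lam_prod n P c = (\<Otimes>\<^bsub>PVTQ n\<^esub>p\<in>P. lam n (fst p) (snd p) [^]\<^bsub>PVTQ n\<^esub> c (fst p) (snd p))"

definition lam_orbit :: "nat \<Rightarrow> (nat \<Rightarrow> nat) \<Rightarrow> nat \<Rightarrow> nat \<Rightarrow> vgen gword set set set" where
  "lam_orbit n \<theta> r s =
    {lam n ((\<theta> [^]\<^bsub>Sn n\<^esub> k) r) ((\<theta> [^]\<^bsub>Sn n\<^esub> k) s) | k::int. True}"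

definition pair_orbits :: "nat \<Rightarrow> (nat \<Rightarrow> nat) \<Rightarrow> nat set set set" where
  "pair_orbits n \<theta> = {{(\<theta> [^]\<^bsub>Sn n\<^esub> k) ` {r, s} | k::int. True} | r s. (r, s) \<in> pairs n}"

definition lam_transversal :: "nat \<Rightarrow> (nat \<Rightarrow> nat) \<Rightarrow> vgen gword set set set \<Rightarrow> bool" where
  "lam_transversal n \<theta> T \<longleftrightarrow>
    T \<subseteq> {lam n i j | i j. (i, j) \<in> pairs n} \<and>
    (\<forall>X \<in> pair_orbits n \<theta>.
       \<exists>!t. t \<in> T \<and> t \<in> {lam n r s | r s. (r, s) \<in> pairs n \<and> {r, s} \<in> X})"

text \<open>The coefficient \<open>a\<^bsub>i,j\<^esub>\<close> for arbitrary \<open>i \<noteq> j\<close>, read as \<open>a\<^bsub>j,i\<^esub>\<close> if \<open>j < i\<close>, and the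
  associated exponent \<open>k\<^bsub>i,j\<^esub>\<close> of the sign.\<close>

definition coeff_at :: "(nat \<Rightarrow> nat \<Rightarrow> int) \<Rightarrow> nat \<Rightarrow> nat \<Rightarrow> int" where
  "coeff_at a i j = (if i < j then a i j else a j i)"

definition sign_exp :: "nat \<Rightarrow> nat \<Rightarrow> nat" where
  "sign_exp i j = (if i < j then 0 else 1)"

definition conjugate_in :: "('a, 'b) monoid_scheme \<Rightarrow> 'a \<Rightarrow> 'a \<Rightarrow> bool" where
  "conjugate_in G x y \<longleftrightarrow> (\<exists>g \<in> carrier G. y = g \<otimes>\<^bsub>G\<^esub> x \<otimes>\<^bsub>G\<^esub> inv\<^bsub>G\<^esub> g)"

end

theory Submission
  imports Defs "HOL-Algebra.Bij"
begin

text \<open>Write \<open>K\<close> for the image of \<open>PVT\<^sub>n\<close> in \<open>VT\<^sub>n / \<Gamma>\<^sub>2(PVT\<^sub>n)\<close>; it is a commutative normal subgroup.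
  Conjugating \<open>u \<sigma>\<close> with \<open>u \<in> K\<close> by an element \<open>x \<in> K\<close> gives
  \<open>u (\<sigma> x \<sigma>\<^sup>-\<^sup>1 x\<^sup>-\<^sup>1)\<^sup>-\<^sup>1 \<sigma>\<close>. The elements \<open>\<sigma> x \<sigma>\<^sup>-\<^sup>1 x\<^sup>-\<^sup>1\<close> form a subgroup \<open>D\<close> of \<open>K\<close>, so
  \<open>u \<sigma>\<close> and \<open>v \<sigma>\<close> are conjugate as soon as \<open>u\<close> and \<open>v\<close> agree modulo \<open>D\<close>
  (\<open>conjugate_in_twisted\<close>), and the theorem becomes a computation in the commutative
  group \<open>K / D\<close>.

  Since \<open>\<sigma> \<lambda>\<^bsub>i,j\<^esub> \<sigma>\<^sup>-\<^sup>1 = \<lambda>\<^bsub>\<theta>(i),\<theta>(j)\<^esub>\<close> (\<open>conj_lam\<close>), the elements \<open>\<lambda>\<^bsub>i,j\<^esub>\<close> and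
  \<open>\<lambda>\<^bsub>\<theta>(i),\<theta>(j)\<^esub>\<close> have the same class in \<open>K / D\<close>. Thus all factors belonging to one
  orbit of unordered pairs collapse to powers of the class of the representative
  \<open>\<lambda>\<^bsub>r,s\<^esub>\<close>, with the sign of the exponent changed wherever \<open>\<theta>\<^sup>i\<close> reverses the order of
  the pair, and the exponents add up. If the orbit contains \<open>\<lambda>\<^bsub>r,s\<^esub>\<^sup>-\<^sup>1\<close>, then the class of \<open>\<lambda>\<^bsub>r,s\<^esub>\<close> is its own
  inverse, so only the parity of the exponent matters; this is why the signs in the second
  formula for \<open>b\<close> may differ from those in the first. This part is
  \<open>finprod_pairs_transversal\<close> and concerns an arbitrary commutative group.

  The formulas for \<open>b\<close> and the transversal speak of sets of group elements, whereas the
  computation runs over pairs of indices. The translation requires the \<open>\<lambda>\<^bsub>i,j\<^esub>\<close> with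
  \<open>i \<noteq> j\<close> to be pairwise distinct in the quotient (\<open>lam_inj\<close>). They are told apart by an
  action of \<open>VT\<^sub>n\<close> on triples \<open>(a, b, m)\<close>, which permutes \<open>a\<close> and \<open>b\<close> and shifts the
  integer \<open>m\<close>: pure elements act by shifts only, so \<open>\<Gamma>\<^sub>2(PVT\<^sub>n)\<close> acts trivially,
  and the shift of \<open>\<lambda>\<^bsub>i,j\<^esub>\<close> reveals \<open>i\<close> and \<open>j\<close>.\<close>

section \<open>Orbits of pairs under a permutation\<close>

lemma funpow_eq_iff_mod_least_power:
  assumes inj: "inj f" and per: "(f ^^ N) x = x" "N > 0"
  shows "(f ^^ i) x = (f ^^ j) x \<longleftrightarrow> i mod least_power f x = j mod least_power f x"
proof -
  let ?m = "least_power f x"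
  have m: "(f ^^ ?m) x = x" "?m > 0" using least_powerI[OF per] by auto
  have red: "(f ^^ k) x = (f ^^ (k mod ?m)) x" for k
    using funpow_mod_eq[OF m(1)] by simp
  have inj_below: "k = l" if "k \<le> l" "l < ?m" "(f ^^ k) x = (f ^^ l) x" for k l
  proof -
    have "(f ^^ (l - k)) x = x" using funpow_diff[OF inj that(1,3)] .
    then have "?m dvd l - k" by (rule least_power_minimal)
    then have "\<not> 0 < l - k" using dvd_imp_le[of ?m "l - k"] that by linarith
    then show ?thesis using that by simp
  qed
  have "i mod ?m = j mod ?m \<longleftrightarrow> (f ^^ (i mod ?m)) x = (f ^^ (j mod ?m)) x"
    using inj_below[of "i mod ?m" "j mod ?m"] inj_below[of "j mod ?m" "i mod ?m"] m(2)
    by (cases "i mod ?m \<le> j mod ?m") auto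
  then show ?thesis using red[of i] red[of j] by simp
qed

lemma funpow_image:
  fixes f :: "'a \<Rightarrow> 'a"
  shows "((`) f ^^ i) A = (f ^^ i) ` A"
  by (induction i) (auto simp: image_comp)

lemma funpow_map_prod:
  fixes f :: "'a \<Rightarrow> 'a" and g :: "'b \<Rightarrow> 'b"
  shows "(map_prod f g ^^ i) (x, y) = ((f ^^ i) x, (g ^^ i) y)"
  by (induction i) auto

text \<open>The orbit of the unordered pair is the orbit of the set \<open>{r, s}\<close> under taking images.\<close>

definition pair_period :: "(nat \<Rightarrow> nat) \<Rightarrow> nat \<Rightarrow> nat \<Rightarrow> nat" where
  "pair_period \<theta> r s = least_power ((`) \<theta>) {r, s}"

definition ordered_orbit :: "(nat \<Rightarrow> nat) \<Rightarrow> nat \<Rightarrow> nat \<Rightarrow> (nat \<times> nat) set" where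
  "ordered_orbit \<theta> r s = range (\<lambda>i. ((\<theta> ^^ i) r, (\<theta> ^^ i) s))"

definition sort_pair :: "nat \<times> nat \<Rightarrow> nat \<times> nat" where
  "sort_pair p = (min (fst p) (snd p), max (fst p) (snd p))"

context
  fixes \<theta> :: "nat \<Rightarrow> nat" and n :: nat
  assumes perm: "\<theta> permutes {1..n}"
begin

lemma permutes_finite_order: obtains N where "N > 0" "\<theta> ^^ N = id"
proof -
  have "permutation \<theta>" using perm permutation_permutes by blast
  then show ?thesis using permutation_is_nilpotent that by blast
qed

lemma image_pow_eq_iff:
  "(\<theta> ^^ i) ` {r, s} = (\<theta> ^^ j) ` {r, s} \<longleftrightarrow> i mod pair_period \<theta> r s = j mod pair_period \<theta> r s"
proof -
  obtain N where N: "N > 0" "\<theta> ^^ N = id" by (rule permutes_finite_order)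
  have "inj ((`) \<theta>)" using permutes_inj[OF perm] by (simp add: inj_image_eq_iff inj_def)
  from funpow_eq_iff_mod_least_power[OF this _ N(1), of "{r, s}"] show ?thesis
    using N(2) by (simp add: funpow_image pair_period_def)
qed

lemma pair_period_pos: "pair_period \<theta> r s > 0"
proof -
  obtain N where N: "N > 0" "\<theta> ^^ N = id" by (rule permutes_finite_order)
  then show ?thesis
    unfolding pair_period_def by (intro least_powerI(2)[of N]) (simp_all add: funpow_image)
qed

text \<open>Let \<open>m\<close> be the period of the unordered pair and \<open>c\<close> that of the ordered pair, so that \<open>m\<close>
  divides \<open>c\<close>. After \<open>m\<close> steps the ordered pair is either restored, and then \<open>c = m\<close> and the
  reversed pair never occurs, or it is reversed, and then \<open>c\<close> divides \<open>2 m\<close> but not \<open>m\<close>.\<close>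

lemma card_ordered_orbit:
  assumes "r \<noteq> s"
  shows "card (ordered_orbit \<theta> r s)
    = (if (s, r) \<in> ordered_orbit \<theta> r s then 2 * pair_period \<theta> r s else pair_period \<theta> r s)"
proof -
  let ?f = "\<lambda>i. ((\<theta> ^^ i) r, (\<theta> ^^ i) s)" and ?m = "pair_period \<theta> r s"
  define c where "c = least_power (map_prod \<theta> \<theta>) (r, s)"
  obtain N where N: "N > 0" "\<theta> ^^ N = id" by (rule permutes_finite_order)
  have inj: "inj (map_prod \<theta> \<theta>)" using permutes_inj[OF perm] by (simp add: prod.inj_map)
  have f_eq: "?f i = ?f j \<longleftrightarrow> i mod c = j mod c" for i j
    using funpow_eq_iff_mod_least_power[OF inj _ N(1), of "(r, s)" i j] N(2)
    by (simp add: funpow_map_prod c_def)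
  have c: "c > 0"
    unfolding c_def by (rule least_powerI(2)[OF _ N(1)]) (simp add: funpow_map_prod N(2))
  have card: "card (ordered_orbit \<theta> r s) = c"
  proof -
    have "inj_on ?f {..<c}" by (rule inj_onI) (simp only: f_eq, simp)
    moreover have "ordered_orbit \<theta> r s = ?f ` {..<c}"
    proof
      show "ordered_orbit \<theta> r s \<subseteq> ?f ` {..<c}"
      proof
        fix p assume "p \<in> ordered_orbit \<theta> r s"
        then obtain i where "p = ?f i" by (auto simp: ordered_orbit_def)
        then have "p = ?f (i mod c)" using f_eq[of i "i mod c"] by simp
        then show "p \<in> ?f ` {..<c}" using c by (intro image_eqI[of _ _ "i mod c"]) auto
      qed
    qed (auto simp: ordered_orbit_def)
    ultimately show ?thesis by (simp add: card_image)
  qed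
  have dvd_c: "?f k = ?f 0 \<longleftrightarrow> c dvd k" for k 
    using f_eq[of k 0] by (simp add: dvd_eq_mod_eq_0)
  have dvd_m: "(\<theta> ^^ k) ` {r, s} = {r, s} \<longleftrightarrow> ?m dvd k" for k
    using image_pow_eq_iff[of k r s 0] by (simp add: dvd_eq_mod_eq_0)
  have "(\<theta> ^^ k) ` {r, s} = {r, s} \<longleftrightarrow> ?f k = (r, s) \<or> ?f k = (s, r)" for k
    by (simp add: doubleton_eq_iff)
  then have m_iff: "?m dvd k \<longleftrightarrow> ?f k = ?f 0 \<or> ?f k = (s, r)" for k using dvd_m[of k] by simp
  have m_dvd_c: "?m dvd c" unfolding m_iff dvd_c by simp
  show ?thesis
  proof (cases "?f ?m = ?f 0")
    case True
    then have "c dvd ?m" by (simp only: dvd_c)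
    then have "c = ?m" using m_dvd_c by (rule dvd_antisym)
    have "?f k \<noteq> (s, r)" for k
    proof
      assume k: "?f k = (s, r)"
      then have "?m dvd k" unfolding m_iff ..
      then have "?f k = ?f 0" unfolding dvd_c \<open>c = ?m\<close> .
      with k show False using assms by simp
    qed
    then have "(s, r) \<notin> ordered_orbit \<theta> r s" unfolding ordered_orbit_def image_iff by metis
    then show ?thesis using card \<open>c = ?m\<close> by simp
  next
    case False
    then have sw: "?f ?m = (s, r)" using m_iff[of ?m] dvd_refl[of ?m] by blast
    then have "?f (?m + ?m) = ?f 0" by (simp add: funpow_add)
    then have "c dvd 2 * ?m" using dvd_c by (simp add: mult_2)
    moreover have "\<not> c dvd ?m" using False dvd_c by blast
    moreover obtain d where d: "c = ?m * d" using m_dvd_c by (rule dvdE)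
    ultimately have "d dvd 2" "d \<noteq> 1" using pair_period_pos[of r s] by (simp_all add: mult.commute)
    moreover from this have "d \<le> 2" by (intro dvd_imp_le) simp_all
    moreover have "d \<noteq> 0" using \<open>d dvd 2\<close> by (intro notI) simp
    ultimately have "d = 2" by linarith
    moreover have "(s, r) \<in> ordered_orbit \<theta> r s"
      unfolding ordered_orbit_def sw[symmetric] by blast
    ultimately show ?thesis using card d by simp
  qed
qed

text \<open>The elements of \<open>pairs n\<close> stand for the unordered pairs. Taking one period of the unordered
  pair as index set treats orbits with and without a reversed pair alike.\<close>

lemma sorted_orbit_bij:
  assumes "(r, s) \<in> pairs n"
  shows "bij_betw (\<lambda>i. sort_pair ((\<theta> ^^ i) r, (\<theta> ^^ i) s)) {..<pair_period \<theta> r s}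
    {q \<in> pairs n. \<exists>i. {fst q, snd q} = (\<theta> ^^ i) ` {r, s}}" (is "bij_betw ?g ?I ?U")
proof -
  have set_g: "{fst (?g i), snd (?g i)} = (\<theta> ^^ i) ` {r, s}" for i
    by (auto simp: sort_pair_def min_def max_def)
  have g_pairs: "?g i \<in> pairs n" for i
  proof -
    have "(\<theta> ^^ i) r \<in> {1..n}" "(\<theta> ^^ i) s \<in> {1..n}"
      using assms permutes_in_image[OF permutes_funpow[OF perm]] by (auto simp: pairs_def)
    moreover have "(\<theta> ^^ i) r \<noteq> (\<theta> ^^ i) s"
      using assms injD[OF permutes_inj[OF permutes_funpow[OF perm, of i]], of r s] by (auto simp: pairs_def)
    ultimately show ?thesis by (auto simp: pairs_def sort_pair_def min_def max_def)
  qed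
  have pair_eqI: "p = q" if "p \<in> pairs n" "q \<in> pairs n" "{fst p, snd p} = {fst q, snd q}" for p q
    using that by (auto simp: pairs_def doubleton_eq_iff)
  show ?thesis
  proof (rule bij_betw_imageI)
    show "inj_on ?g ?I"
    proof (rule inj_onI)
      fix i j assume "i \<in> ?I" "j \<in> ?I" "?g i = ?g j"
      then have "(\<theta> ^^ i) ` {r, s} = (\<theta> ^^ j) ` {r, s}" using set_g by metis
      then show "i = j" using image_pow_eq_iff \<open>i \<in> ?I\<close> \<open>j \<in> ?I\<close> by simp
    qed
    show "?g ` ?I = ?U"
    proof
      show "?g ` ?I \<subseteq> ?U" using set_g g_pairs by blast
      show "?U \<subseteq> ?g ` ?I"
      proof
        fix q assume "q \<in> ?U"
        then obtain i where q: "q \<in> pairs n" and i: "{fst q, snd q} = (\<theta> ^^ i) ` {r, s}" by blast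
        let ?i = "i mod pair_period \<theta> r s"
        have "{fst q, snd q} = (\<theta> ^^ ?i) ` {r, s}" unfolding i image_pow_eq_iff by simp
        then have "q = ?g ?i" using q g_pairs set_g by (metis pair_eqI)
        then show "q \<in> ?g ` ?I" using pair_period_pos[of r s] by (intro image_eqI[of _ _ ?i]) auto
      qed
    qed
  qed
qed

text \<open>Lying in the same orbit is symmetric although only natural powers occur: \<open>\<theta>\<close> has
  finite order.\<close>

lemma image_orbit_sym:
  assumes "B = (\<theta> ^^ i) ` A"
  shows "\<exists>j. A = (\<theta> ^^ j) ` B"
proof -
  obtain N where N: "N > 0" "\<theta> ^^ N = id" by (rule permutes_finite_order)
  have id: "\<theta> ^^ (N * i) = id" using N(2) by (simp add: funpow_mult[symmetric] flip: id_def)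
  have "(\<theta> ^^ (N * i - i)) ` B = (\<theta> ^^ (N * i - i + i)) ` A"
    unfolding assms by (simp add: funpow_add image_comp)
  also have "N * i - i + i = N * i" using N(1) by simp
  finally show ?thesis using id by (metis image_id id_apply)
qed

end

section \<open>Products over orbits in a commutative group\<close>

context comm_group
begin

lemma finprod_int_pow:
  assumes "finite I" "x \<in> carrier G"
  shows "(\<Otimes>i\<in>I. x [^] (c i :: int)) = x [^] (\<Sum>i\<in>I. c i)"
  using assms by (induction I rule: finite_induct) (auto simp: Pi_iff int_pow_mult)

text \<open>Sorting the pair \<open>(\<theta>\<^sup>i(r), \<theta>\<^sup>i(s))\<close> replaces \<open>M r s\<close> by its inverse exactly when
  \<open>\<theta>\<^sup>i\<close> reverses the order, so each factor is a power of \<open>M r s\<close> and the exponents add up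
  over one period. If \<open>(s, r)\<close> lies in the orbit, invariance gives \<open>M s r = M r s\<close>, hence
  \<open>M r s\<close> is its own inverse and the exponent may be changed by even numbers.\<close>

lemma finprod_orbit:
  fixes a b :: "nat \<Rightarrow> nat \<Rightarrow> int"
  assumes perm: "\<theta> permutes {1..n}"
    and M: "\<And>i j. i \<in> {1..n} \<Longrightarrow> j \<in> {1..n} \<Longrightarrow> i \<noteq> j \<Longrightarrow> M i j \<in> carrier G"
    and swap: "\<And>i j. i \<in> {1..n} \<Longrightarrow> j \<in> {1..n} \<Longrightarrow> i \<noteq> j \<Longrightarrow> M j i = inv (M i j)"
    and invar: "\<And>i j. i \<in> {1..n} \<Longrightarrow> j \<in> {1..n} \<Longrightarrow> i \<noteq> j \<Longrightarrow> M (\<theta> i) (\<theta> j) = M i j"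
    and rs: "(r, s) \<in> pairs n"
    and b1: "(s, r) \<notin> ordered_orbit \<theta> r s \<Longrightarrow> b r s = a r s + (\<Sum>i = 1..card (ordered_orbit \<theta> r s) - 1.
            (-1) ^ sign_exp ((\<theta> ^^ i) r) ((\<theta> ^^ i) s) * coeff_at a ((\<theta> ^^ i) r) ((\<theta> ^^ i) s))"
    and b2: "(s, r) \<in> ordered_orbit \<theta> r s \<Longrightarrow> b r s = a r s - (\<Sum>i = 1..card (ordered_orbit \<theta> r s) div 2 - 1.
            coeff_at a ((\<theta> ^^ i) r) ((\<theta> ^^ i) s))"
  shows "(\<Otimes>p\<in>{q \<in> pairs n. \<exists>i. {fst q, snd q} = (\<theta> ^^ i) ` {r, s}}. M (fst p) (snd p) [^] a (fst p) (snd p))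
    = M r s [^] b r s"
proof -
  let ?m = "pair_period \<theta> r s" and ?g = "\<lambda>i. sort_pair ((\<theta> ^^ i) r, (\<theta> ^^ i) s)"
  define c where "c i = coeff_at a ((\<theta> ^^ i) r) ((\<theta> ^^ i) s)" for i
  define e where "e i = (-1 :: int) ^ sign_exp ((\<theta> ^^ i) r) ((\<theta> ^^ i) s)" for i
  have rs': "r \<in> {1..n}" "s \<in> {1..n}" "r < s" using rs by (auto simp: pairs_def)
  have in_range: "(\<theta> ^^ i) r \<in> {1..n}" "(\<theta> ^^ i) s \<in> {1..n}" for i
    using rs' permutes_in_image[OF permutes_funpow[OF perm]] by auto
  have neq: "(\<theta> ^^ i) r \<noteq> (\<theta> ^^ i) s" for i
    using rs' inj_eq[OF permutes_inj[OF permutes_funpow[OF perm, of i]], of r s] by simp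
  have x: "M r s \<in> carrier G" using rs' by (intro M) simp_all
  have M_pow: "M ((\<theta> ^^ i) r) ((\<theta> ^^ i) s) = M r s" for i
  proof (induction i)
    case (Suc i)
    then show ?case using invar[OF in_range[of i] neq[of i]] by simp
  qed simp
  have factor: "M (fst (?g i)) (snd (?g i)) [^] a (fst (?g i)) (snd (?g i)) = M r s [^] (e i * c i)" for i
  proof (cases "(\<theta> ^^ i) r < (\<theta> ^^ i) s")
    case True
    then show ?thesis using M_pow[of i] by (simp add: sort_pair_def e_def c_def sign_exp_def coeff_at_def)
  next
    case False
    then have "M (fst (?g i)) (snd (?g i)) = inv (M r s)"
      using swap[OF in_range[of i] neq[of i]] M_pow[of i] by (simp add: sort_pair_def)
    then show ?thesis using False x
      by (simp add: sort_pair_def e_def c_def sign_exp_def coeff_at_def int_pow_inv int_pow_neg)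
  qed
  have "(\<Otimes>p\<in>{q \<in> pairs n. \<exists>i. {fst q, snd q} = (\<theta> ^^ i) ` {r, s}}. M (fst p) (snd p) [^] a (fst p) (snd p))
      = (\<Otimes>i\<in>{..<?m}. M (fst (?g i)) (snd (?g i)) [^] a (fst (?g i)) (snd (?g i)))"
  proof -
    let ?F = "\<lambda>p. M (fst p) (snd p) [^] a (fst p) (snd p)"
    have "inj_on ?g {..<?m}"
      and im: "?g ` {..<?m} = {q \<in> pairs n. \<exists>i. {fst q, snd q} = (\<theta> ^^ i) ` {r, s}}"
      using sorted_orbit_bij[OF perm rs] by (auto simp only: bij_betw_def)
    moreover have "?F \<in> ?g ` {..<?m} \<rightarrow> carrier G" using x factor by auto
    ultimately show ?thesis unfolding im[symmetric] by (intro finprod_reindex)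
  qed
  also have "\<dots> = M r s [^] (\<Sum>i<?m. e i * c i)"
    unfolding factor using x by (simp add: finprod_int_pow)
  also have "\<dots> = M r s [^] b r s"
  proof (cases "(s, r) \<in> ordered_orbit \<theta> r s")
    case False
    have card: "card (ordered_orbit \<theta> r s) = ?m" using card_ordered_orbit[OF perm, of r s] False rs' by simp
    have "{..<?m} = insert 0 {1..?m - 1}" using pair_period_pos[OF perm, of r s] by auto
    then have "(\<Sum>i<?m. e i * c i) = e 0 * c 0 + (\<Sum>i = 1..?m - 1. e i * c i)" by simp
    also have "e 0 * c 0 = a r s" using rs' by (simp add: e_def c_def sign_exp_def coeff_at_def)
    finally show ?thesis using b1[OF False] card by (simp add: e_def c_def)
  next
    case True
    have card: "card (ordered_orbit \<theta> r s) div 2 = ?m" using card_ordered_orbit[OF perm, of r s] True rs' by simp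
    obtain k where k: "(\<theta> ^^ k) r = s" "(\<theta> ^^ k) s = r" using True by (auto simp: ordered_orbit_def)
    have "M s r = M r s" using M_pow[of k] unfolding k .
    moreover have "M s r = inv (M r s)" using rs' by (intro swap) auto
    ultimately have invol: "inv (M r s) = M r s" by metis
    \<comment> \<open>Only the parity of the exponent matters for an element that is its own inverse.\<close>
    have even_pow: "M r s [^] (y + 2 * z) = M r s [^] y" for y z :: int
    proof -
      have "M r s [^] z = inv (M r s) [^] z" by (simp add: invol)
      then have "M r s [^] z \<otimes> M r s [^] z = M r s [^] z \<otimes> inv (M r s [^] z)"
        using x by (simp add: int_pow_inv)
      then have "M r s [^] (z + z) = \<one>" using x by (simp only: int_pow_mult r_inv int_pow_closed)
      then show ?thesis
        using x by (simp only: int_pow_mult mult_2 r_one int_pow_closed)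
    qed
    have "{..<?m} = insert 0 {1..?m - 1}" using pair_period_pos[OF perm, of r s] by auto
    then have "(\<Sum>i<?m. e i * c i) = e 0 * c 0 + (\<Sum>i = 1..?m - 1. e i * c i)" by simp
    also have "e 0 * c 0 = a r s" using rs' by (simp add: e_def c_def sign_exp_def coeff_at_def)
    \<comment> \<open>Every sign \<open>e i\<close> equals \<open>-1\<close> up to an even correction.\<close>
    also have "(\<Sum>i = 1..?m - 1. e i * c i)
        = - (\<Sum>i = 1..?m - 1. c i) + 2 * (\<Sum>i = 1..?m - 1. if e i = 1 then c i else 0)"
      by (simp add: sum_distrib_left flip: sum_negf sum.distrib)
         (rule sum.cong, auto simp: e_def sign_exp_def)
    finally have "(\<Sum>i<?m. e i * c i) = b r s + 2 * (\<Sum>i = 1..?m - 1. if e i = 1 then c i else 0)"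
      using b2[OF True] card by (simp add: c_def)
    then show ?thesis using even_pow by simp
  qed
  finally show ?thesis .
qed

text \<open>Every pair lies in the orbit of exactly one representative, so the product over all pairs
  splits into the products over the orbits.\<close>

lemma finprod_pairs_transversal:
  fixes a b :: "nat \<Rightarrow> nat \<Rightarrow> int"
  assumes perm: "\<theta> permutes {1..n}"
    and M: "\<And>i j. i \<in> {1..n} \<Longrightarrow> j \<in> {1..n} \<Longrightarrow> i \<noteq> j \<Longrightarrow> M i j \<in> carrier G"
    and swap: "\<And>i j. i \<in> {1..n} \<Longrightarrow> j \<in> {1..n} \<Longrightarrow> i \<noteq> j \<Longrightarrow> M j i = inv (M i j)"
    and invar: "\<And>i j. i \<in> {1..n} \<Longrightarrow> j \<in> {1..n} \<Longrightarrow> i \<noteq> j \<Longrightarrow> M (\<theta> i) (\<theta> j) = M i j"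
    and R: "R \<subseteq> pairs n"
    and trans: "\<And>p. p \<in> pairs n \<Longrightarrow> \<exists>!q. q \<in> R \<and> (\<exists>i. {fst q, snd q} = (\<theta> ^^ i) ` {fst p, snd p})"
    and b1: "\<And>r s. (r, s) \<in> R \<Longrightarrow> (s, r) \<notin> ordered_orbit \<theta> r s \<Longrightarrow>
          b r s = a r s + (\<Sum>i = 1..card (ordered_orbit \<theta> r s) - 1.
            (-1) ^ sign_exp ((\<theta> ^^ i) r) ((\<theta> ^^ i) s) * coeff_at a ((\<theta> ^^ i) r) ((\<theta> ^^ i) s))"
    and b2: "\<And>r s. (r, s) \<in> R \<Longrightarrow> (s, r) \<in> ordered_orbit \<theta> r s \<Longrightarrow>
          b r s = a r s - (\<Sum>i = 1..card (ordered_orbit \<theta> r s) div 2 - 1.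
            coeff_at a ((\<theta> ^^ i) r) ((\<theta> ^^ i) s))"
  shows "(\<Otimes>p\<in>pairs n. M (fst p) (snd p) [^] a (fst p) (snd p))
    = (\<Otimes>p\<in>R. M (fst p) (snd p) [^] b (fst p) (snd p))"
proof -
  define U where "U q = {p \<in> pairs n. \<exists>i. {fst p, snd p} = (\<theta> ^^ i) ` {fst q, snd q}}" for q
  have fin: "finite (pairs n)"
    by (rule finite_subset[of _ "{1..n} \<times> {1..n}"]) (auto simp: pairs_def)
  have cover: "pairs n = (\<Union>q\<in>R. U q)"
  proof
    show "pairs n \<subseteq> (\<Union>q\<in>R. U q)"
    proof
      fix p assume p: "p \<in> pairs n"
      then obtain q i where q: "q \<in> R" "{fst q, snd q} = (\<theta> ^^ i) ` {fst p, snd p}"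
        using trans by blast
      then show "p \<in> (\<Union>q\<in>R. U q)" using image_orbit_sym[OF perm q(2)] p unfolding U_def by blast
    qed
  qed (auto simp: U_def)
  have disj: "U q \<inter> U q' = {}" if "q \<in> R" "q' \<in> R" "q \<noteq> q'" for q q'
  proof (rule ccontr)
    assume "U q \<inter> U q' \<noteq> {}"
    then obtain p i j where p: "p \<in> pairs n" and i: "{fst p, snd p} = (\<theta> ^^ i) ` {fst q, snd q}"
      and j: "{fst p, snd p} = (\<theta> ^^ j) ` {fst q', snd q'}" unfolding U_def by blast
    show False
      using trans[OF p] image_orbit_sym[OF perm i] image_orbit_sym[OF perm j] that by metis
  qed
  have factor: "M (fst p) (snd p) [^] k \<in> carrier G" if "p \<in> pairs n" for p and k :: int
    using that M by (intro int_pow_closed) (auto simp: pairs_def)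
  have U_sub: "U q \<subseteq> pairs n" for q by (auto simp: U_def)
  have "(\<Otimes>p\<in>pairs n. M (fst p) (snd p) [^] a (fst p) (snd p))
      = (\<Otimes>q\<in>R. \<Otimes>p\<in>U q. M (fst p) (snd p) [^] a (fst p) (snd p))"
    unfolding cover
  proof (rule finprod_UN_disjoint)
    show "pairwise (\<lambda>p q. disjnt (U p) (U q)) R"
      using disj by (simp add: pairwise_def disjnt_def)
    show "M (fst p) (snd p) [^] a (fst p) (snd p) \<in> carrier G" if "p \<in> U q" for p q
      using factor U_sub that by blast
  qed (use finite_subset[OF R fin] finite_subset[OF U_sub fin] in auto)
  also have "\<dots> = (\<Otimes>p\<in>R. M (fst p) (snd p) [^] b (fst p) (snd p))"
  proof (rule finprod_cong')
    fix q assume q: "q \<in> R"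
    obtain r s where rs: "q = (r, s)" by (cases q)
    show "(\<Otimes>p\<in>U q. M (fst p) (snd p) [^] a (fst p) (snd p)) = M (fst q) (snd q) [^] b (fst q) (snd q)"
      unfolding U_def rs fst_conv snd_conv
      using q rs R by (intro finprod_orbit[where M = M, OF perm M swap invar] b1 b2) auto
  qed (use factor R in auto)
  finally show ?thesis .
qed

end

section \<open>Twisted commutators and conjugacy\<close>

lemma hom_finprod:
  assumes "comm_group G" "comm_group H" "h \<in> hom G H" "f \<in> A \<rightarrow> carrier G"
  shows "h (finprod G f A) = finprod H (\<lambda>x. h (f x)) A"
proof -
  interpret G: comm_group G by fact
  interpret H: comm_group H by fact
  interpret h: group_hom G H h by unfold_locales (fact assms(3))
  show ?thesis using assms(4)
    by (induction A rule: infinite_finite_induct) (auto simp: Pi_iff)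
qed

text \<open>For \<open>K\<close> commutative and normal this is the image of the endomorphism
  \<open>x \<mapsto> \<sigma> x \<sigma>\<^sup>-\<^sup>1 x\<^sup>-\<^sup>1\<close> of \<open>K\<close>.\<close>

definition twisted_commutators :: "('a, 'b) monoid_scheme \<Rightarrow> 'a set \<Rightarrow> 'a \<Rightarrow> 'a set" where
  "twisted_commutators G K \<sigma> = (\<lambda>x. \<sigma> \<otimes>\<^bsub>G\<^esub> x \<otimes>\<^bsub>G\<^esub> inv\<^bsub>G\<^esub> \<sigma> \<otimes>\<^bsub>G\<^esub> inv\<^bsub>G\<^esub> x) ` K"

context group
begin

context
  fixes K \<sigma>
  assumes K: "K \<lhd> G" and comm: "\<And>x y. x \<in> K \<Longrightarrow> y \<in> K \<Longrightarrow> x \<otimes> y = y \<otimes> x"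
    and \<sigma>: "\<sigma> \<in> carrier G"
begin

interpretation K: normal K G by (rule K)

lemma subgroup_twisted_commutators: "subgroup (twisted_commutators G K \<sigma>) (G\<lparr>carrier := K\<rparr>)"
proof -
  define c where "c x = \<sigma> \<otimes> x \<otimes> inv \<sigma>" for x
  have cK: "c x \<in> K" if "x \<in> K" for x unfolding c_def by (rule K.inv_op_closed2[OF \<sigma> that])
  have c_mult: "c (x \<otimes> y) = c x \<otimes> c y" if "x \<in> K" "y \<in> K" for x y
  proof -
    have "c x \<otimes> c y = \<sigma> \<otimes> x \<otimes> (inv \<sigma> \<otimes> (\<sigma> \<otimes> (y \<otimes> inv \<sigma>)))"
      using \<sigma> K.mem_carrier that by (simp add: c_def m_assoc)
    then show ?thesis using \<sigma> K.mem_carrier that by (simp add: c_def inv_solve_left m_assoc flip: m_assoc[of "inv \<sigma>" \<sigma>])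
  qed
  have c_inv: "c (inv x) = inv (c x)" if "x \<in> K" for x
    using \<sigma> K.mem_carrier that by (simp add: c_def inv_mult_group m_assoc)
  have D: "twisted_commutators G K \<sigma> = (\<lambda>x. c x \<otimes> inv x) ` K"
    by (simp add: twisted_commutators_def c_def)
  have sub: "(\<lambda>x. c x \<otimes> inv x) ` K \<subseteq> K" using cK by auto
  have "subgroup ((\<lambda>x. c x \<otimes> inv x) ` K) G"
  proof (rule subgroupI)
    show "(\<lambda>x. c x \<otimes> inv x) ` K \<subseteq> carrier G" using sub K.subset by blast
    show "(\<lambda>x. c x \<otimes> inv x) ` K \<noteq> {}" using K.one_closed by blast
  next
    fix d assume "d \<in> (\<lambda>x. c x \<otimes> inv x) ` K"
    then obtain x where x: "x \<in> K" "d = c x \<otimes> inv x" by blast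
    have "inv d = x \<otimes> inv (c x)"
      using x cK K.mem_carrier by (simp add: inv_mult_group)
    also have "\<dots> = inv (c x) \<otimes> x" using x cK by (intro comm) auto
    also have "\<dots> = c (inv x) \<otimes> inv (inv x)" using x K.mem_carrier by (simp add: c_inv)
    finally show "inv d \<in> (\<lambda>x. c x \<otimes> inv x) ` K" using x(1) by blast
  next
    fix d e assume "d \<in> (\<lambda>x. c x \<otimes> inv x) ` K" "e \<in> (\<lambda>x. c x \<otimes> inv x) ` K"
    then obtain x y where x: "x \<in> K" "d = c x \<otimes> inv x" and y: "y \<in> K" "e = c y \<otimes> inv y" by blast
    have mem: "c x \<in> K" "c y \<in> K" "inv x \<in> K" "inv y \<in> K" using x y cK by auto
    note car = mem[THEN K.mem_carrier]
    have "d \<otimes> e = c x \<otimes> ((inv x \<otimes> c y) \<otimes> inv y)" using x y car by (simp add: m_assoc)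
    also have "inv x \<otimes> c y = c y \<otimes> inv x" using mem by (intro comm)
    also have "c x \<otimes> (c y \<otimes> inv x \<otimes> inv y) = c x \<otimes> c y \<otimes> (inv x \<otimes> inv y)" using car by (simp add: m_assoc)
    also have "inv x \<otimes> inv y = inv y \<otimes> inv x" using mem by (intro comm)
    also have "c x \<otimes> c y \<otimes> (inv y \<otimes> inv x) = c (x \<otimes> y) \<otimes> inv (x \<otimes> y)"
      using x y K.mem_carrier by (simp add: c_mult inv_mult_group)
    finally show "d \<otimes> e \<in> (\<lambda>x. c x \<otimes> inv x) ` K" using x(1) y(1) by blast
  qed
  then show ?thesis unfolding D by (rule subgroup_incl[OF _ K.subgroup_axioms sub])
qed

text \<open>The conjugating element is \<open>x\<close> itself: moving \<open>x\<^sup>-\<^sup>1\<close> across \<open>\<sigma>\<close> turns it into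
  \<open>\<sigma> x\<^sup>-\<^sup>1 \<sigma>\<^sup>-\<^sup>1\<close>, which cancels the twisted commutator because \<open>K\<close> is commutative.\<close>

lemma conjugate_in_twisted:
  assumes "x \<in> K" "v \<in> K"
  shows "conjugate_in G (\<sigma> \<otimes> x \<otimes> inv \<sigma> \<otimes> inv x \<otimes> v \<otimes> \<sigma>) (v \<otimes> \<sigma>)"
proof -
  have car: "x \<in> carrier G" "v \<in> carrier G" using assms K.mem_carrier by auto
  let ?c = "\<sigma> \<otimes> x \<otimes> inv \<sigma>"
  have c: "?c \<in> K" by (rule K.inv_op_closed2[OF \<sigma> assms(1)])
  have cc: "?c \<in> carrier G" using c K.mem_carrier by blast
  have "x \<otimes> (?c \<otimes> inv x \<otimes> v \<otimes> \<sigma>) \<otimes> inv x = (x \<otimes> ?c) \<otimes> (inv x \<otimes> v) \<otimes> (\<sigma> \<otimes> inv x)"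
    using car cc \<sigma> by (simp add: m_assoc)
  also have "x \<otimes> ?c = ?c \<otimes> x" using assms c by (intro comm)
  also have "?c \<otimes> x \<otimes> (inv x \<otimes> v) = ?c \<otimes> (x \<otimes> inv x \<otimes> v)" using car cc by (simp only: m_assoc m_closed inv_closed)
  also have "\<dots> = v \<otimes> ?c" using car comm[OF c assms(2)] by simp
  also have "v \<otimes> ?c \<otimes> (\<sigma> \<otimes> inv x) = v \<otimes> (\<sigma> \<otimes> (x \<otimes> ((inv \<sigma> \<otimes> \<sigma>) \<otimes> inv x)))"
    using car \<sigma> by (simp only: m_assoc m_closed inv_closed)
  also have "\<dots> = v \<otimes> \<sigma>" using car \<sigma> by simp
  finally show ?thesis unfolding conjugate_in_def using car by (intro bexI[of _ x]) auto
qed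

end
end

section \<open>Generators and relations of the virtual twin group\<close>

lemma vt_rels_lists: "vt_rels n \<subseteq> lists (vt_gens n \<times> UNIV) \<times> lists (vt_gens n \<times> UNIV)"
  by (auto simp: vt_rels_def pos_word_def vt_gens_def)

lemma group_VT: "group (VT n)"
  unfolding VT_def by (rule group_presented_group[OF vt_rels_lists])

lemma pos_word_lists: "set gs \<subseteq> vt_gens n \<Longrightarrow> pos_word gs \<in> lists (vt_gens n \<times> UNIV)"
  by (auto simp: pos_word_def)

lemma vt_word_closed [simp]: "set gs \<subseteq> vt_gens n \<Longrightarrow> vt_word n gs \<in> carrier (VT n)"
  unfolding vt_word_def VT_def presented_group_carrier by (intro imageI pos_word_lists)

lemma vt_word_Nil: "vt_word n [] = \<one>\<^bsub>VT n\<^esub>"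
  by (simp add: vt_word_def VT_def presented_group_def pos_word_def)

lemma vt_word_append:
  "set gs \<subseteq> vt_gens n \<Longrightarrow> set hs \<subseteq> vt_gens n \<Longrightarrow>
    vt_word n (gs @ hs) = vt_word n gs \<otimes>\<^bsub>VT n\<^esub> vt_word n hs"
  unfolding vt_word_def VT_def
  by (subst presented_mult_class[OF vt_rels_lists pos_word_lists pos_word_lists])
     (auto simp: pos_word_def)

lemma vt_word_Cons:
  "g \<in> vt_gens n \<Longrightarrow> set gs \<subseteq> vt_gens n \<Longrightarrow>
    vt_word n (g # gs) = vt_word n [g] \<otimes>\<^bsub>VT n\<^esub> vt_word n gs"
  using vt_word_append[of "[g]" n gs] by simp

lemma vt_word_relation:
  assumes "(pos_word gs, pos_word hs) \<in> vt_rels n"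
  shows "vt_word n gs = vt_word n hs"
proof -
  have "word_cong (vt_gens n) (vt_rels n) (pos_word gs) (pos_word hs)"
    by (rule word_cong.relation[OF assms])
  then show ?thesis
    unfolding vt_word_def
    using word_class_eq_iff[OF vt_rels_lists] word_cong_lists[OF vt_rels_lists] by blast
qed

lemma vt_gens_simps [simp]:
  "Sig i \<in> vt_gens n \<longleftrightarrow> 1 \<le> i \<and> i < n" "Rho i \<in> vt_gens n \<longleftrightarrow> 1 \<le> i \<and> i < n"
  by (auto simp: vt_gens_def)

abbreviation sg :: "nat \<Rightarrow> nat \<Rightarrow> vgen gword set" where "sg n i \<equiv> vt_word n [Sig i]"
abbreviation rh :: "nat \<Rightarrow> nat \<Rightarrow> vgen gword set" where "rh n i \<equiv> vt_word n [Rho i]"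

lemma vt_gen_square:
  assumes "g \<in> vt_gens n"
  shows "vt_word n [g] \<otimes>\<^bsub>VT n\<^esub> vt_word n [g] = \<one>\<^bsub>VT n\<^esub>"
proof -
  have "(pos_word [g, g], pos_word []) \<in> vt_rels n"
    using assms unfolding vt_rels_def vt_gens_def by (intro imageI[where f = "map_prod pos_word pos_word", of "(_, _)", simplified map_prod_simp]) auto
  then show ?thesis
    using vt_word_relation vt_word_Cons[of g n "[g]"] assms by (simp add: vt_word_Nil)
qed

lemma vt_far_commute:
  assumes "1 \<le> i" "i < n" "1 \<le> j" "j < n" "i + 2 \<le> j \<or> j + 2 \<le> i"
  shows "rh n i \<otimes>\<^bsub>VT n\<^esub> rh n j = rh n j \<otimes>\<^bsub>VT n\<^esub> rh n i"
    and "rh n i \<otimes>\<^bsub>VT n\<^esub> sg n j = sg n j \<otimes>\<^bsub>VT n\<^esub> rh n i"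
proof -
  have "(pos_word [Rho i, Rho j], pos_word [Rho j, Rho i]) \<in> vt_rels n"
    unfolding vt_rels_def using assms
    by (intro imageI[where f = "map_prod pos_word pos_word", of "(_, _)", simplified map_prod_simp]) auto
  moreover have "(pos_word [Rho i, Sig j], pos_word [Sig j, Rho i]) \<in> vt_rels n"
    unfolding vt_rels_def using assms
    by (intro imageI[where f = "map_prod pos_word pos_word", of "(_, _)", simplified map_prod_simp]) auto
  ultimately show "rh n i \<otimes>\<^bsub>VT n\<^esub> rh n j = rh n j \<otimes>\<^bsub>VT n\<^esub> rh n i"
    and "rh n i \<otimes>\<^bsub>VT n\<^esub> sg n j = sg n j \<otimes>\<^bsub>VT n\<^esub> rh n i"
    using assms vt_word_relation by (simp_all flip: vt_word_append)
qed

lemma vt_braid: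
  assumes "1 \<le> i" "i + 1 < n"
  shows "rh n i \<otimes>\<^bsub>VT n\<^esub> (rh n (i+1) \<otimes>\<^bsub>VT n\<^esub> rh n i)
       = rh n (i+1) \<otimes>\<^bsub>VT n\<^esub> (rh n i \<otimes>\<^bsub>VT n\<^esub> rh n (i+1))"
    and "rh n i \<otimes>\<^bsub>VT n\<^esub> (rh n (i+1) \<otimes>\<^bsub>VT n\<^esub> sg n i)
       = sg n (i+1) \<otimes>\<^bsub>VT n\<^esub> (rh n i \<otimes>\<^bsub>VT n\<^esub> rh n (i+1))"
proof -
  have "(pos_word [Rho i, Rho (i+1), Rho i], pos_word [Rho (i+1), Rho i, Rho (i+1)]) \<in> vt_rels n"
    unfolding vt_rels_def using assms
    by (intro imageI[where f = "map_prod pos_word pos_word", of "(_, _)", simplified map_prod_simp]) auto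
  moreover have "(pos_word [Rho i, Rho (i+1), Sig i], pos_word [Sig (i+1), Rho i, Rho (i+1)]) \<in> vt_rels n"
    unfolding vt_rels_def using assms
    by (intro imageI[where f = "map_prod pos_word pos_word", of "(_, _)", simplified map_prod_simp]) auto
  ultimately show "rh n i \<otimes>\<^bsub>VT n\<^esub> (rh n (i+1) \<otimes>\<^bsub>VT n\<^esub> rh n i)
       = rh n (i+1) \<otimes>\<^bsub>VT n\<^esub> (rh n i \<otimes>\<^bsub>VT n\<^esub> rh n (i+1))"
    and "rh n i \<otimes>\<^bsub>VT n\<^esub> (rh n (i+1) \<otimes>\<^bsub>VT n\<^esub> sg n i)
       = sg n (i+1) \<otimes>\<^bsub>VT n\<^esub> (rh n i \<otimes>\<^bsub>VT n\<^esub> rh n (i+1))"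
    using assms vt_word_relation by (simp_all flip: vt_word_append)
qed

section \<open>Conjugation of the \<open>\<lambda>\<^bsub>i,j\<^esub>\<close> by the generators \<open>\<rho>\<^bsub>k\<^esub>\<close>\<close>

text \<open>Conjugation by \<open>\<rho>\<^bsub>k\<^esub>\<close>, which is its own inverse. With these maps the equivariance of the
  \<open>\<lambda>\<^bsub>i,j\<^esub>\<close> becomes a computation with involutions that satisfy the braid relations.\<close>

definition rho_conj :: "nat \<Rightarrow> nat \<Rightarrow> vgen gword set \<Rightarrow> vgen gword set" where
  "rho_conj n k x = rh n k \<otimes>\<^bsub>VT n\<^esub> (x \<otimes>\<^bsub>VT n\<^esub> rh n k)"

context
  fixes n :: nat
begin

interpretation group "VT n" by (rule group_VT)

lemma involution_cancel:
  assumes "a \<otimes>\<^bsub>VT n\<^esub> a = \<one>\<^bsub>VT n\<^esub>" "a \<in> carrier (VT n)" "x \<in> carrier (VT n)"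
  shows "a \<otimes>\<^bsub>VT n\<^esub> (a \<otimes>\<^bsub>VT n\<^esub> x) = x"
  using assms by (simp flip: m_assoc)

text \<open>The generators are involutions, so every element is a product of generators and inverse
  letters need no separate case.\<close>

lemma VT_induct [consumes 1, case_names one gen]:
  assumes "x \<in> carrier (VT n)"
    and one: "P \<one>\<^bsub>VT n\<^esub>"
    and gen: "\<And>g x. g \<in> vt_gens n \<Longrightarrow> x \<in> carrier (VT n) \<Longrightarrow> P x \<Longrightarrow> P (vt_word n [g] \<otimes>\<^bsub>VT n\<^esub> x)"
  shows "P x"
proof -
  let ?c = "word_class (vt_gens n) (vt_rels n)"
  have "P (?c w) \<and> ?c w \<in> carrier (VT n)" if "w \<in> lists (vt_gens n \<times> UNIV)" for w
    using that
  proof induction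
    case Nil
    then show ?case using one vt_word_Nil[of n] by (simp add: vt_word_def pos_word_def)
  next
    case (Cons l w)
    obtain g e where l: "l = (g, e)" and g: "g \<in> vt_gens n" using Cons.hyps by (cases l) auto
    have m: "?c (u @ v) = ?c u \<otimes>\<^bsub>VT n\<^esub> ?c v"
      if "u \<in> lists (vt_gens n \<times> UNIV)" "v \<in> lists (vt_gens n \<times> UNIV)" for u v
      unfolding VT_def by (rule presented_mult_class[OF vt_rels_lists that, symmetric])
    have pos: "?c [(g, True)] = vt_word n [g]" by (simp add: vt_word_def pos_word_def)
    have "?c [(g, e)] = vt_word n [g]"
    proof (cases e)
      case False
      have cl: "?c [(g, False)] \<in> carrier (VT n)"
        unfolding VT_def presented_group_carrier using g by (intro imageI) auto
      have "?c ([(g, True)] @ [(g, False)]) = ?c []"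
        by (subst word_class_eq_iff[OF vt_rels_lists])
           (use word_cong.cancel[OF g, of "vt_rels n" True] g in auto)
      moreover have "?c [] = \<one>\<^bsub>VT n\<^esub>"
        using vt_word_Nil[of n] by (simp add: vt_word_def pos_word_def)
      ultimately have "vt_word n [g] \<otimes>\<^bsub>VT n\<^esub> ?c [(g, False)] = \<one>\<^bsub>VT n\<^esub>"
        using m[of "[(g, True)]" "[(g, False)]"] g by (simp only: pos) simp
      then have "inv\<^bsub>VT n\<^esub> (?c [(g, False)]) = vt_word n [g]"
        using g cl by (intro inv_equality) simp_all
      moreover have "inv\<^bsub>VT n\<^esub> (vt_word n [g]) = vt_word n [g]"
        using vt_gen_square[OF g] g by (intro inv_equality) simp_all
      ultimately have "?c [(g, False)] = vt_word n [g]"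
        using inv_inv[OF cl] by simp
      then show ?thesis using False by simp
    qed (use pos in simp)
    then have "?c (l # w) = vt_word n [g] \<otimes>\<^bsub>VT n\<^esub> ?c w"
      using m[of "[l]" w] Cons.hyps l g by simp
    moreover have "vt_word n [g] \<otimes>\<^bsub>VT n\<^esub> ?c w \<in> carrier (VT n)"
      using Cons.IH g by (intro m_closed) simp_all
    ultimately show ?case using gen[OF g] Cons.IH by simp
  qed
  moreover obtain w where "w \<in> lists (vt_gens n \<times> UNIV)" "x = ?c w"
    using assms(1) unfolding VT_def presented_group_carrier by (rule imageE) blast
  ultimately show ?thesis by blast
qed

lemma rho_conj_closed [simp]:
  "1 \<le> k \<Longrightarrow> k < n \<Longrightarrow> x \<in> carrier (VT n) \<Longrightarrow> rho_conj n k x \<in> carrier (VT n)"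
  by (simp add: rho_conj_def)

lemma rho_conj_rho_conj:
  "1 \<le> k \<Longrightarrow> k < n \<Longrightarrow> x \<in> carrier (VT n) \<Longrightarrow> rho_conj n k (rho_conj n k x) = x"
  using vt_gen_square[of "Rho k" n] by (simp add: rho_conj_def m_assoc involution_cancel)

lemma rho_conj_inv:
  assumes "1 \<le> k" "k < n" "x \<in> carrier (VT n)"
  shows "rho_conj n k (inv\<^bsub>VT n\<^esub> x) = inv\<^bsub>VT n\<^esub> (rho_conj n k x)"
proof -
  have "inv\<^bsub>VT n\<^esub> (rh n k) = rh n k"
    using assms vt_gen_square[of "Rho k" n] by (intro inv_equality) auto
  then show ?thesis using assms by (simp add: rho_conj_def inv_mult_group m_assoc)
qed

lemma rho_conj_fixed:
  assumes "1 \<le> k" "k < n" "x \<in> carrier (VT n)"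
    and "rh n k \<otimes>\<^bsub>VT n\<^esub> x = x \<otimes>\<^bsub>VT n\<^esub> rh n k"
  shows "rho_conj n k x = x"
  using assms(1-3) vt_gen_square[of "Rho k" n] by (simp add: rho_conj_def involution_cancel flip: assms(4))

lemma rho_conj_commute:
  assumes "1 \<le> k" "k < n" "1 \<le> l" "l < n" "k + 2 \<le> l \<or> l + 2 \<le> k" "x \<in> carrier (VT n)"
  shows "rho_conj n k (rho_conj n l x) = rho_conj n l (rho_conj n k x)"
proof -
  let ?a = "rh n k" and ?b = "rh n l"
  have c: "?a \<in> carrier (VT n)" "?b \<in> carrier (VT n)" using assms by auto
  have ab: "?a \<otimes>\<^bsub>VT n\<^esub> ?b = ?b \<otimes>\<^bsub>VT n\<^esub> ?a" using vt_far_commute(1) assms by blast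
  have "rho_conj n k (rho_conj n l x) = (?a \<otimes>\<^bsub>VT n\<^esub> ?b) \<otimes>\<^bsub>VT n\<^esub> x \<otimes>\<^bsub>VT n\<^esub> (?b \<otimes>\<^bsub>VT n\<^esub> ?a)"
    using c assms(6) by (simp add: rho_conj_def m_assoc)
  also have "\<dots> = (?b \<otimes>\<^bsub>VT n\<^esub> ?a) \<otimes>\<^bsub>VT n\<^esub> x \<otimes>\<^bsub>VT n\<^esub> (?a \<otimes>\<^bsub>VT n\<^esub> ?b)"
    by (metis ab)
  also have "\<dots> = rho_conj n l (rho_conj n k x)"
    using c assms(6) by (simp add: rho_conj_def m_assoc)
  finally show ?thesis .
qed

lemma rho_conj_braid:
  assumes "1 \<le> k" "k + 1 < n" "x \<in> carrier (VT n)"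
  shows "rho_conj n k (rho_conj n (k+1) (rho_conj n k x))
    = rho_conj n (k+1) (rho_conj n k (rho_conj n (k+1) x))"
proof -
  let ?a = "rh n k" and ?b = "rh n (k+1)"
  have c: "?a \<in> carrier (VT n)" "?b \<in> carrier (VT n)" using assms by auto
  have "rho_conj n k (rho_conj n (k+1) (rho_conj n k x))
      = (?a \<otimes>\<^bsub>VT n\<^esub> (?b \<otimes>\<^bsub>VT n\<^esub> ?a)) \<otimes>\<^bsub>VT n\<^esub> x \<otimes>\<^bsub>VT n\<^esub> (?a \<otimes>\<^bsub>VT n\<^esub> (?b \<otimes>\<^bsub>VT n\<^esub> ?a))"
    using c assms(3) by (simp add: rho_conj_def m_assoc)
  also have "\<dots> = rho_conj n (k+1) (rho_conj n k (rho_conj n (k+1) x))"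
    unfolding vt_braid(1)[OF assms(1,2)] using c assms(3) by (simp add: rho_conj_def m_assoc)
  finally show ?thesis .
qed

lemma lam_pos_closed [simp]:
  assumes "1 \<le> i" "i < j" "j \<le> n"
  shows "lam_pos n i j \<in> carrier (VT n)"
proof -
  have "set (map Rho (rev [i+1..<j])) \<subseteq> vt_gens n" using assms by auto
  moreover have "set [Sig i, Rho i] \<subseteq> vt_gens n" using assms by auto
  ultimately show ?thesis unfolding lam_pos_def Let_def by (intro m_closed inv_closed vt_word_closed)
qed

lemma lam_pos_base: "1 \<le> i \<Longrightarrow> i < n \<Longrightarrow> lam_pos n i (i+1) = sg n i \<otimes>\<^bsub>VT n\<^esub> rh n i"
  by (simp add: lam_pos_def vt_word_Nil flip: vt_word_append)

text \<open>The conjugating word of \<open>\<lambda>\<^bsub>i,j+1\<^esub>\<close> is \<open>\<rho>\<^bsub>j\<^esub>\<close> followed by that of \<open>\<lambda>\<^bsub>i,j\<^esub>\<close>. This recursion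
  drives all inductions below.\<close>

lemma lam_pos_step:
  assumes "1 \<le> i" "i < j" "j < n"
  shows "lam_pos n i (j+1) = rho_conj n j (lam_pos n i j)"
proof -
  let ?w = "map Rho (rev [i+1..<j])"
  have w: "set ?w \<subseteq> vt_gens n" using assms by auto
  have 1: "vt_word n (map Rho (rev [i+1..<j+1])) = rh n j \<otimes>\<^bsub>VT n\<^esub> vt_word n ?w"
    using assms w by (simp flip: vt_word_Cons)
  have 2: "inv\<^bsub>VT n\<^esub> (rh n j) = rh n j"
    using assms vt_gen_square[of "Rho j" n] by (intro inv_equality) auto
  have c: "rh n j \<in> carrier (VT n)" "vt_word n ?w \<in> carrier (VT n)"
    "vt_word n [Sig i, Rho i] \<in> carrier (VT n)"
    using w assms by (auto simp del: set_map)
  show ?thesis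
    unfolding lam_pos_def Let_def 1 rho_conj_def
    using c by (simp add: inv_mult_group m_assoc 2)
qed

lemma rho_conj_lam_base:
  assumes "1 \<le> i" "i < n"
  shows "rho_conj n i (lam_pos n i (i+1)) = inv\<^bsub>VT n\<^esub> (lam_pos n i (i+1))"
proof -
  have c: "sg n i \<in> carrier (VT n)" "rh n i \<in> carrier (VT n)" using assms by auto
  have i: "inv\<^bsub>VT n\<^esub> (rh n i) = rh n i" "inv\<^bsub>VT n\<^esub> (sg n i) = sg n i"
    using assms vt_gen_square[of "Rho i" n] vt_gen_square[of "Sig i" n] by (intro inv_equality; simp)+
  show ?thesis
    unfolding lam_pos_base[OF assms] rho_conj_def
    using c vt_gen_square[of _ n] assms by (simp add: inv_mult_group m_assoc i)
qed

lemma rho_conj_lam_far: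
  assumes "1 \<le> i" "i < j" "j \<le> n" "1 \<le> k" "k < n" "k + 2 \<le> i \<or> j + 1 \<le> k"
  shows "rho_conj n k (lam_pos n i j) = lam_pos n i j"
proof -
  have "Suc i \<le> j" using assms by simp
  then show ?thesis using assms(3,6)
  proof (induction j rule: dec_induct)
    case base
    have c: "sg n i \<in> carrier (VT n)" "rh n i \<in> carrier (VT n)" "rh n k \<in> carrier (VT n)"
      using assms by auto
    have "rh n k \<otimes>\<^bsub>VT n\<^esub> sg n i = sg n i \<otimes>\<^bsub>VT n\<^esub> rh n k"
      and "rh n k \<otimes>\<^bsub>VT n\<^esub> rh n i = rh n i \<otimes>\<^bsub>VT n\<^esub> rh n k"
      using base assms by (intro vt_far_commute; linarith)+
    then have "rh n k \<otimes>\<^bsub>VT n\<^esub> (sg n i \<otimes>\<^bsub>VT n\<^esub> rh n i)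
        = (sg n i \<otimes>\<^bsub>VT n\<^esub> rh n i) \<otimes>\<^bsub>VT n\<^esub> rh n k"
      using c by (metis m_assoc)
    then have "rho_conj n k (sg n i \<otimes>\<^bsub>VT n\<^esub> rh n i) = sg n i \<otimes>\<^bsub>VT n\<^esub> rh n i"
      using c assms by (intro rho_conj_fixed) auto
    then show ?case using lam_pos_base[of i] base assms by simp
  next
    case (step j)
    then show ?case
      using assms lam_pos_step[of i j] rho_conj_commute[of k j "lam_pos n i j"] by auto
  qed
qed

text \<open>Conjugation by \<open>\<rho>\<^bsub>k\<^esub>\<close> on \<open>\<lambda>\<^bsub>i,k+2\<^esub>\<close>, which arises from \<open>\<lambda>\<^bsub>i,k\<^esub>\<close> by \<open>\<rho>\<^bsub>k\<^esub>\<close> and then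
  \<open>\<rho>\<^bsub>k+1\<^esub>\<close>: the braid relation moves \<open>\<rho>\<^bsub>k+1\<^esub>\<close> to the inside, where it fixes
  \<open>\<lambda>\<^bsub>i,k\<^esub>\<close>. Later letters commute with \<open>\<rho>\<^bsub>k\<^esub>\<close>.\<close>

lemma rho_conj_lam_inside:
  assumes "1 \<le> i" "i < k" "k + 1 < j" "j \<le> n"
  shows "rho_conj n k (lam_pos n i j) = lam_pos n i j"
proof -
  have "k + 2 \<le> j" using assms by simp
  then show ?thesis using assms(4)
  proof (induction j rule: dec_induct)
    case base
    have c: "lam_pos n i k \<in> carrier (VT n)" using assms base by simp
    have "lam_pos n i (k+2) = rho_conj n (k+1) (rho_conj n k (lam_pos n i k))"
      using lam_pos_step[of i k] lam_pos_step[of i "k+1"] assms base by simp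
    then have "rho_conj n k (lam_pos n i (k+2))
        = rho_conj n (k+1) (rho_conj n k (rho_conj n (k+1) (lam_pos n i k)))"
      using rho_conj_braid[of k] assms base c by simp
    also have "rho_conj n (k+1) (lam_pos n i k) = lam_pos n i k"
      using assms base by (intro rho_conj_lam_far) auto
    finally show ?case using lam_pos_step[of i k] lam_pos_step[of i "k+1"] assms base by simp
  next
    case (step j)
    then show ?case
      using assms lam_pos_step[of i j] rho_conj_commute[of k j "lam_pos n i j"] by auto
  qed
qed

text \<open>The case \<open>j = i + 2\<close> is where the mixed relation
  \<open>\<rho>\<^bsub>i\<^esub> \<rho>\<^bsub>i+1\<^esub> \<sigma>\<^bsub>i\<^esub> = \<sigma>\<^bsub>i+1\<^esub> \<rho>\<^bsub>i\<^esub> \<rho>\<^bsub>i+1\<^esub>\<close> enters; for larger \<open>j\<close> the further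
  conjugations commute with \<open>\<rho>\<^bsub>i\<^esub>\<close>.\<close>

lemma rho_conj_lam_left:
  assumes "1 \<le> i" "i + 1 < j" "j \<le> n"
  shows "rho_conj n i (lam_pos n (i+1) j) = lam_pos n i j"
proof -
  have "i + 2 \<le> j" using assms by simp
  then show ?thesis using assms(3)
  proof (induction j rule: dec_induct)
    case base
    let ?r = "rh n i" and ?r' = "rh n (i+1)" and ?s = "sg n i" and ?s' = "sg n (i+1)"
    have i: "1 \<le> i" "i + 1 < n" using assms base by auto
    have c: "?r \<in> carrier (VT n)" "?r' \<in> carrier (VT n)" "?s \<in> carrier (VT n)" "?s' \<in> carrier (VT n)"
      using i by auto
    have sq: "?r \<otimes>\<^bsub>VT n\<^esub> ?r = \<one>\<^bsub>VT n\<^esub>" "?r' \<otimes>\<^bsub>VT n\<^esub> ?r' = \<one>\<^bsub>VT n\<^esub>"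
      using i by (auto intro!: vt_gen_square)
    note canc = involution_cancel[OF sq(1) c(1)] involution_cancel[OF sq(2) c(2)]
    have "rho_conj n (i+1) (lam_pos n i (i+1)) = ?r' \<otimes>\<^bsub>VT n\<^esub> (?s \<otimes>\<^bsub>VT n\<^esub> (?r \<otimes>\<^bsub>VT n\<^esub> ?r'))"
      using i c by (simp add: rho_conj_def lam_pos_base[of i, simplified] m_assoc)
    also have "\<dots> = ?r \<otimes>\<^bsub>VT n\<^esub> ((?r \<otimes>\<^bsub>VT n\<^esub> (?r' \<otimes>\<^bsub>VT n\<^esub> ?s)) \<otimes>\<^bsub>VT n\<^esub> (?r \<otimes>\<^bsub>VT n\<^esub> ?r'))"
      using c by (simp add: m_assoc canc)
    also have "\<dots> = ?r \<otimes>\<^bsub>VT n\<^esub> (?s' \<otimes>\<^bsub>VT n\<^esub> ((?r \<otimes>\<^bsub>VT n\<^esub> (?r' \<otimes>\<^bsub>VT n\<^esub> ?r)) \<otimes>\<^bsub>VT n\<^esub> ?r'))"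
      unfolding vt_braid(2)[OF i] using c by (simp add: m_assoc)
    also have "\<dots> = ?r \<otimes>\<^bsub>VT n\<^esub> (?s' \<otimes>\<^bsub>VT n\<^esub> (?r' \<otimes>\<^bsub>VT n\<^esub> ?r))"
      unfolding vt_braid(1)[OF i] using c sq by (simp add: m_assoc)
    also have "\<dots> = rho_conj n i (lam_pos n (i+1) (i+2))"
      using i c lam_pos_base[of "i+1"] by (simp add: rho_conj_def m_assoc)
    finally show ?case using lam_pos_step[of i "i+1"] i by simp
  next
    case (step j)
    then show ?case
      using assms lam_pos_step[of "i+1" j] lam_pos_step[of i j]
        rho_conj_commute[of i j "lam_pos n (i+1) j"] by auto
  qed
qed

lemma rho_conj_lam_pos:
  assumes "1 \<le> i" "i < j" "j \<le> n" "1 \<le> k" "k < n"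
  shows "rho_conj n k (lam_pos n i j) = lam_VT n (transpose k (k+1) i) (transpose k (k+1) j)"
proof -
  consider "k + 2 \<le> i \<or> j + 1 \<le> k" | "i < k" "k + 1 < j" | "i = k + 1" | "i = k" "j = k + 1"
    | "i = k" "k + 1 < j" | "i < k" "j = k + 1" | "j = k"
    using assms by linarith
  then show ?thesis
  proof cases
    case 1
    then show ?thesis using rho_conj_lam_far assms by (auto simp: lam_VT_def transpose_def)
  next
    case 2
    then show ?thesis using rho_conj_lam_inside assms by (auto simp: lam_VT_def transpose_def)
  next
    case 3
    then show ?thesis using rho_conj_lam_left[of k j] assms by (auto simp: lam_VT_def transpose_def)
  next
    case 4
    then show ?thesis using rho_conj_lam_base[of k] assms by (auto simp: lam_VT_def transpose_def)
  next
    case 5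
    then have "rho_conj n k (rho_conj n k (lam_pos n (k+1) j)) = lam_pos n (k+1) j"
      using assms by (intro rho_conj_rho_conj) auto
    then show ?thesis
      using rho_conj_lam_left[of k j] 5 assms by (auto simp: lam_VT_def transpose_def)
  next
    case 6
    then have "rho_conj n k (rho_conj n k (lam_pos n i k)) = lam_pos n i k"
      using assms by (intro rho_conj_rho_conj) auto
    then show ?thesis
      using lam_pos_step[of i k] 6 assms by (auto simp: lam_VT_def transpose_def)
  next
    case 7
    then show ?thesis using lam_pos_step[of i k] assms by (auto simp: lam_VT_def transpose_def)
  qed
qed

lemma lam_VT_closed [simp]:
  "i \<in> {1..n} \<Longrightarrow> j \<in> {1..n} \<Longrightarrow> i \<noteq> j \<Longrightarrow> lam_VT n i j \<in> carrier (VT n)"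
  by (auto simp: lam_VT_def)

lemma lam_VT_swap:
  "i \<in> {1..n} \<Longrightarrow> j \<in> {1..n} \<Longrightarrow> i \<noteq> j \<Longrightarrow> lam_VT n j i = inv\<^bsub>VT n\<^esub> (lam_VT n i j)"
  by (auto simp: lam_VT_def)

text \<open>Reversing the indices inverts \<open>\<lambda>\<close>, and conjugation respects inverses, so the case of
  increasing indices suffices.\<close>

lemma rho_conj_lam_VT:
  assumes "i \<in> {1..n}" "j \<in> {1..n}" "i \<noteq> j" "1 \<le> k" "k < n"
  shows "rho_conj n k (lam_VT n i j) = lam_VT n (transpose k (k+1) i) (transpose k (k+1) j)"
proof (cases "i < j")
  case True
  then show ?thesis using rho_conj_lam_pos[of i j k] assms by (simp add: lam_VT_def)
next
  case False
  then have ji: "j < i" using assms by simp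
  have in_range: "transpose k (k+1) l \<in> {1..n}" if "l \<in> {1..n}" for l
    using that assms by (auto simp: transpose_def)
  have "rho_conj n k (lam_VT n i j) = inv\<^bsub>VT n\<^esub> (rho_conj n k (lam_pos n j i))"
    using ji assms by (simp add: lam_VT_def rho_conj_inv)
  also have "\<dots> = inv\<^bsub>VT n\<^esub> (lam_VT n (transpose k (k+1) j) (transpose k (k+1) i))"
    using rho_conj_lam_pos[of j i k] ji assms by simp
  also have "\<dots> = lam_VT n (transpose k (k+1) i) (transpose k (k+1) j)"
    by (rule lam_VT_swap[symmetric]) (use in_range assms in \<open>auto dest: injD[OF inj_transpose]\<close>)
  finally show ?thesis .
qed
end

section \<open>Homomorphisms out of the virtual twin group\<close>

text \<open>To verify all relations for some interpretation \<open>E\<close> of positive words it is enough to treat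
  the squares, the far commutations and the two relations of length three.\<close>

lemma vt_rels_respected:
  assumes "(u, v) \<in> vt_rels n"
    and "\<And>g. g \<in> vt_gens n \<Longrightarrow> E [g, g] = E []"
    and "\<And>i j. 1 \<le> i \<Longrightarrow> i < n \<Longrightarrow> 1 \<le> j \<Longrightarrow> j < n \<Longrightarrow> i + 2 \<le> j \<or> j + 2 \<le> i \<Longrightarrow>
      E [Sig i, Sig j] = E [Sig j, Sig i] \<and> E [Rho i, Rho j] = E [Rho j, Rho i] \<and>
      E [Rho i, Sig j] = E [Sig j, Rho i]"
    and "\<And>i. 1 \<le> i \<Longrightarrow> i + 1 < n \<Longrightarrow>
      E [Rho i, Rho (i+1), Rho i] = E [Rho (i+1), Rho i, Rho (i+1)] \<and>
      E [Rho i, Rho (i+1), Sig i] = E [Sig (i+1), Rho i, Rho (i+1)]"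
  shows "\<exists>gs hs. u = pos_word gs \<and> v = pos_word hs \<and> E gs = E hs"
proof -
  from assms(1) obtain p where uv: "(u, v) = map_prod pos_word pos_word p"
    and "p \<in> {([Sig i, Sig i], []) | i. i \<in> {1..n-1}}
      \<union> {([Rho i, Rho i], []) | i. i \<in> {1..n-1}}
      \<union> {([Sig i, Sig j], [Sig j, Sig i]) | i j.
            i \<in> {1..n-1} \<and> j \<in> {1..n-1} \<and> \<bar>int i - int j\<bar> \<ge> 2}
      \<union> {([Rho i, Rho j], [Rho j, Rho i]) | i j.
            i \<in> {1..n-1} \<and> j \<in> {1..n-1} \<and> \<bar>int i - int j\<bar> \<ge> 2}
      \<union> {([Rho i, Sig j], [Sig j, Rho i]) | i j.
            i \<in> {1..n-1} \<and> j \<in> {1..n-1} \<and> \<bar>int i - int j\<bar> \<ge> 2}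
      \<union> {([Rho i, Rho (i+1), Rho i], [Rho (i+1), Rho i, Rho (i+1)]) | i. i \<in> {1..n-2}}
      \<union> {([Rho i, Rho (i+1), Sig i], [Sig (i+1), Rho i, Rho (i+1)]) | i. i \<in> {1..n-2}}" (is "p \<in> ?R")
    unfolding vt_rels_def by (rule imageE)
  then obtain gs hs where p: "p = (gs, hs)" "(gs, hs) \<in> ?R" by (metis prod.exhaust)
  have "E gs = E hs"
    using p(2) unfolding Un_iff mem_Collect_eq prod.inject
  proof (elim disjE exE conjE, goal_cases)
    case (1 i)
    then have "Sig i \<in> vt_gens n" by auto
    from assms(2)[OF this] 1 show ?thesis by simp
  next
    case (2 i)
    then have "Rho i \<in> vt_gens n" by auto
    from assms(2)[OF this] 2 show ?thesis by simp
  next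
    case (3 i j)
    then have "1 \<le> i" "i < n" "1 \<le> j" "j < n" "i + 2 \<le> j \<or> j + 2 \<le> i" by auto
    from assms(3)[OF this] 3 show ?thesis by metis
  next
    case (4 i j)
    then have "1 \<le> i" "i < n" "1 \<le> j" "j < n" "i + 2 \<le> j \<or> j + 2 \<le> i" by auto
    from assms(3)[OF this] 4 show ?thesis by metis
  next
    case (5 i j)
    then have "1 \<le> i" "i < n" "1 \<le> j" "j < n" "i + 2 \<le> j \<or> j + 2 \<le> i" by auto
    from assms(3)[OF this] 5 show ?thesis by metis
  next
    case (6 i)
    then have "1 \<le> i" "i + 1 < n" by auto
    from assms(4)[OF this] 6 show ?thesis by metis
  next
    case (7 i)
    then have "1 \<le> i" "i + 1 < n" by auto
    from assms(4)[OF this] 7 show ?thesis by metis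
  qed
  moreover have "u = pos_word gs" "v = pos_word hs" using uv by (simp_all add: p(1))
  ultimately show ?thesis by blast
qed

text \<open>The universal property of \<open>VT\<^sub>n\<close>.\<close>

lemma VT_lift:
  assumes "group H" and f: "f \<in> vt_gens n \<rightarrow> carrier H"
    and rel: "\<And>u v. (u, v) \<in> vt_rels n \<Longrightarrow> word_eval H f u = word_eval H f v"
  shows "presented_lift H f \<in> hom (VT n) H"
    and "g \<in> vt_gens n \<Longrightarrow> presented_lift H f (vt_word n [g]) = f g"
proof -
  interpret H: group H by fact
  let ?c = "word_class (vt_gens n) (vt_rels n)"
  have val: "presented_lift H f (?c w) = word_eval H f w" if "w \<in> lists (vt_gens n \<times> UNIV)" for w
    by (rule H.presented_lift_class[OF vt_rels_lists f rel that])
  have rep: "\<exists>w \<in> lists (vt_gens n \<times> UNIV). x = ?c w" if "x \<in> carrier (VT n)" for x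
    using that unfolding VT_def presented_group_carrier by (rule imageE) (rule bexI)
  show "presented_lift H f \<in> hom (VT n) H"
  proof (rule homI)
    fix x assume "x \<in> carrier (VT n)"
    from rep[OF this] obtain u where u: "u \<in> lists (vt_gens n \<times> UNIV)" "x = ?c u" by (rule bexE)
    show "presented_lift H f x \<in> carrier H"
      unfolding u(2) val[OF u(1)] by (rule H.word_eval_closed[OF f u(1)])
    fix y assume "y \<in> carrier (VT n)"
    from rep[OF this] obtain v where v: "v \<in> lists (vt_gens n \<times> UNIV)" "y = ?c v" by (rule bexE)
    have uv: "u @ v \<in> lists (vt_gens n \<times> UNIV)" using u v by simp
    have "x \<otimes>\<^bsub>VT n\<^esub> y = ?c (u @ v)"
      unfolding u(2) v(2) VT_def by (rule presented_mult_class[OF vt_rels_lists u(1) v(1)])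
    then show "presented_lift H f (x \<otimes>\<^bsub>VT n\<^esub> y) = presented_lift H f x \<otimes>\<^bsub>H\<^esub> presented_lift H f y"
      by (simp only: u(2) v(2) val[OF u(1)] val[OF v(1)] val[OF uv] H.word_eval_append[OF f u(1) v(1)])
  qed
  assume g: "g \<in> vt_gens n"
  then have fg: "f g \<in> carrier H" using f by auto
  have "presented_lift H f (vt_word n [g]) = word_eval H f (pos_word [g])"
    unfolding vt_word_def using g by (intro val pos_word_lists) simp_all
  then show "presented_lift H f (vt_word n [g]) = f g"
    using fg by (simp add: pos_word_def)
qed

lemma Sn_simps [simp]:
  "carrier (Sn n) = {p. p permutes {1..n}}" "p \<otimes>\<^bsub>Sn n\<^esub> q = q \<circ> p" "\<one>\<^bsub>Sn n\<^esub> = id"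
  by (auto simp: Sn_def sym_group_def)

lemma group_Sn: "group (Sn n)"
proof (rule groupI)
  fix p assume "p \<in> carrier (Sn n)"
  then show "\<exists>q\<in>carrier (Sn n). q \<otimes>\<^bsub>Sn n\<^esub> p = \<one>\<^bsub>Sn n\<^esub>"
    by (intro bexI[of _ "inv' p"]) (auto simp: permutes_inv permutes_inv_o)
qed (auto simp: permutes_compose permutes_id comp_assoc)

lemma gen_perm_permutes: "g \<in> vt_gens n \<Longrightarrow> gen_perm g permutes {1..n}"
  by (cases g) (auto intro!: permutes_swap_id)

lemma gen_perm_relations:
  assumes "(u, v) \<in> vt_rels n"
  shows "word_eval (Sn n) gen_perm u = word_eval (Sn n) gen_perm v"
proof -
  have sq: "gen_perm g \<circ> gen_perm g = id" for g by (cases g) auto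
  have "\<exists>gs hs. u = pos_word gs \<and> v = pos_word hs \<and>
      word_eval (Sn n) gen_perm (pos_word gs) = word_eval (Sn n) gen_perm (pos_word hs)"
  proof (rule vt_rels_respected[OF assms], goal_cases)
    case (1 g)
    then show ?case by (simp add: pos_word_def sq)
  next
    case (2 i j)
    then show ?case by (auto simp: pos_word_def fun_eq_iff transpose_def)
  next
    case (3 i)
    show ?case by (auto simp: pos_word_def fun_eq_iff transpose_def)
  qed
  then show ?thesis by auto
qed

lemma group_hom_vt_pi: "group_hom (VT n) (Sn n) (vt_pi n)"
  and vt_pi_gen: "g \<in> vt_gens n \<Longrightarrow> vt_pi n (vt_word n [g]) = gen_perm g"
  unfolding vt_pi_def
  using VT_lift[where H = "Sn n" and f = gen_perm and n = n, OF group_Sn _ gen_perm_relations] gen_perm_permutes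
  by (auto simp: group_hom_def group_hom_axioms_def group_VT group_Sn)

lemma Sn_pow: "\<theta> [^]\<^bsub>Sn n\<^esub> (k :: nat) = \<theta> ^^ k"
proof (induction k)
  case (Suc k)
  then show ?case by (simp add: nat_pow_def)
qed (simp add: nat_pow_def)

lemma Sn_int_pow:
  assumes "\<theta> permutes {1..n}"
  shows "\<exists>i::nat. \<theta> [^]\<^bsub>Sn n\<^esub> (k :: int) = \<theta> ^^ i"
proof -
  interpret group "Sn n" by (rule group_Sn)
  obtain N where N: "N > 0" "\<theta> ^^ N = id" using permutes_finite_order[OF assms] by blast
  show ?thesis
  proof (cases "k < 0")
    case True
    define m where "m = nat (- k)"
    have "\<theta> ^^ (N * m) = id" by (simp add: funpow_mult[symmetric] N(2))
    moreover have "N * m = m + (N * m - m)" using N(1) by simp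
    ultimately have "\<theta> ^^ m \<circ> \<theta> ^^ (N * m - m) = id" by (metis funpow_add)
    then have "inv\<^bsub>Sn n\<^esub> (\<theta> ^^ m) = \<theta> ^^ (N * m - m)"
      using permutes_funpow[OF assms] by (intro inv_equality) auto
    then show ?thesis using True by (auto simp: int_pow_def2 Sn_pow m_def)
  qed (auto simp: int_pow_def2 Sn_pow)
qed

text \<open>The orbits are defined with integer powers; since \<open>\<theta>\<close> has finite order, natural powers
  suffice.\<close>

lemma Sn_int_pow_image:
  assumes "\<theta> permutes {1..n}"
  shows "{f (\<theta> [^]\<^bsub>Sn n\<^esub> k) | k::int. True} = range (\<lambda>i::nat. f (\<theta> ^^ i))"
proof
  show "{f (\<theta> [^]\<^bsub>Sn n\<^esub> k) | k::int. True} \<subseteq> range (\<lambda>i::nat. f (\<theta> ^^ i))"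
  proof
    fix y assume "y \<in> {f (\<theta> [^]\<^bsub>Sn n\<^esub> k) | k::int. True}"
    then obtain k :: int where y: "y = f (\<theta> [^]\<^bsub>Sn n\<^esub> k)" by blast
    obtain i :: nat where "\<theta> [^]\<^bsub>Sn n\<^esub> k = \<theta> ^^ i" using Sn_int_pow[OF assms] by blast
    then show "y \<in> range (\<lambda>i::nat. f (\<theta> ^^ i))" unfolding y by simp
  qed
  show "range (\<lambda>i::nat. f (\<theta> ^^ i)) \<subseteq> {f (\<theta> [^]\<^bsub>Sn n\<^esub> k) | k::int. True}"
  proof
    fix y assume "y \<in> range (\<lambda>i::nat. f (\<theta> ^^ i))"
    then obtain i where "y = f (\<theta> [^]\<^bsub>Sn n\<^esub> int i)" by (auto simp: int_pow_int Sn_pow)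
    then show "y \<in> {f (\<theta> [^]\<^bsub>Sn n\<^esub> k) | k::int. True}" by blast
  qed
qed

section \<open>The \<open>\<lambda>\<^bsub>i,j\<^esub>\<close> are distinct modulo \<open>\<Gamma>\<^sub>2\<close>\<close>

fun pair_weight :: "vgen \<Rightarrow> nat \<Rightarrow> nat \<Rightarrow> int" where
  "pair_weight (Rho i) a b = 0"
| "pair_weight (Sig i) a b = of_bool (a = i \<and> b = i+1) - of_bool (a = i+1 \<and> b = i)"

text \<open>The generators act on triples: \<open>\<rho>\<^bsub>i\<^esub>\<close> permutes the two indices, and \<open>\<sigma>\<^bsub>i\<^esub>\<close> moreover shifts
  the integer by an amount that is antisymmetric in the indices, which makes its square
  trivial. The image of \<open>VT\<^sub>n\<close> is contained in the semidirect product of the finitary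
  permutations and the antisymmetric integer functions of two indices.\<close>

definition pair_shift :: "vgen \<Rightarrow> nat \<times> nat \<times> int \<Rightarrow> nat \<times> nat \<times> int" where
  "pair_shift g = (\<lambda>(a, b, m). (gen_perm g a, gen_perm g b, m + pair_weight g a b))"

lemma pair_shift_apply:
  "pair_shift g (a, b, m) = (gen_perm g a, gen_perm g b, m + pair_weight g a b)"
  by (simp add: pair_shift_def)

abbreviation shift_group :: "(nat \<times> nat \<times> int \<Rightarrow> nat \<times> nat \<times> int) monoid" where
  "shift_group \<equiv> BijGroup UNIV"

lemma shift_group_simps:
  "f \<in> carrier shift_group \<longleftrightarrow> bij f" "\<one>\<^bsub>shift_group\<^esub> = id"
  "bij f \<Longrightarrow> bij g \<Longrightarrow> f \<otimes>\<^bsub>shift_group\<^esub> g = f \<circ> g"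
  by (auto simp: BijGroup_def Bij_def compose_def fun_eq_iff)

lemma pair_shift_square: "pair_shift g \<circ> pair_shift g = id"
proof -
  have "pair_weight g (gen_perm g a) (gen_perm g b) = - pair_weight g a b" for a b
    by (cases g) (auto simp: transpose_eq_iff)
  moreover have "gen_perm g (gen_perm g a) = a" for a by (cases g) auto
  ultimately show ?thesis by (auto simp: fun_eq_iff pair_shift_apply)
qed

lemma bij_pair_shift: "bij (pair_shift g)"
  using pair_shift_square[of g] by (rule o_bij)  (rule pair_shift_square)

lemma word_eval_pair_shift:
  "word_eval shift_group pair_shift (pos_word gs) = foldr pair_shift gs"
proof -
  have "bij (foldr pair_shift gs)" for gs
    by (induction gs) (simp_all only: foldr.simps bij_id bij_comp bij_pair_shift)
  then show ?thesis
    by (induction gs) (simp_all add: pos_word_def shift_group_simps bij_pair_shift)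
qed

lemma pair_shift_relations:
  assumes "(u, v) \<in> vt_rels n"
  shows "word_eval shift_group pair_shift u = word_eval shift_group pair_shift v"
proof -
  have "\<exists>gs hs. u = pos_word gs \<and> v = pos_word hs \<and> foldr pair_shift gs = foldr pair_shift hs"
  proof (rule vt_rels_respected[OF assms], goal_cases)
    case (1 g)
    then show ?case by (simp add: pair_shift_square)
  next
    case (2 i j)
    \<comment> \<open>The permutation parts commute, and neither generator moves the two indices at which the
      other one has weight.\<close>
    have perm: "transpose i (i+1) (transpose j (j+1) a) = transpose j (j+1) (transpose i (i+1) a)" for a
      using 2(5) by (auto simp: transpose_def)
    have untouched: "transpose k (k+1) a = l \<longleftrightarrow> a = l" "transpose k (k+1) a = l+1 \<longleftrightarrow> a = l+1"
      if "k + 2 \<le> l \<or> l + 2 \<le> k" for k l a :: nat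
      using that by (auto simp: transpose_def)
    have far: "j + 2 \<le> i \<or> i + 2 \<le> j" using 2(5) by blast
    have weight: "pair_weight (Sig l) (transpose k (k+1) a) (transpose k (k+1) b) = pair_weight (Sig l) a b"
      if "k + 2 \<le> l \<or> l + 2 \<le> k" for k l a b
      using untouched[OF that] by simp
    have eq: "foldr pair_shift [g, h] = foldr pair_shift [h, g]"
      if "gen_perm g = transpose i (i+1)" "gen_perm h = transpose j (j+1)"
        "g = Sig i \<or> g = Rho i" "h = Sig j \<or> h = Rho j" for g h
      using that weight[OF far] weight[OF 2(5)] perm
      by (auto simp: fun_eq_iff pair_shift_apply simp del: pair_weight.simps(2))
    show ?case by (intro conjI eq) simp_all
  next
    case (3 i)
    have perm: "transpose i (i+1) (transpose (i+1) (i+2) (transpose i (i+1) a))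
      = transpose (i+1) (i+2) (transpose i (i+1) (transpose (i+1) (i+2) a))" for a
      by (auto simp: transpose_def)
    have "transpose i (i+1) (transpose (i+1) (i+2) a) = i+1 \<longleftrightarrow> a = i"
      "transpose i (i+1) (transpose (i+1) (i+2) a) = i+2 \<longleftrightarrow> a = i+1" for a
      by (auto simp: transpose_def)
    with perm show ?case by (auto simp: fun_eq_iff pair_shift_apply)
  qed
  then show ?thesis using word_eval_pair_shift by metis
qed

definition shift_hom :: "vgen gword set \<Rightarrow> nat \<times> nat \<times> int \<Rightarrow> nat \<times> nat \<times> int" where
  "shift_hom = presented_lift shift_group pair_shift"

lemma group_hom_shift_hom: "group_hom (VT n) shift_group shift_hom"
  and shift_hom_gen: "g \<in> vt_gens n \<Longrightarrow> shift_hom (vt_word n [g]) = pair_shift g"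
  unfolding shift_hom_def
  using VT_lift[where n = n, OF group_BijGroup _ pair_shift_relations] bij_pair_shift
  by (auto simp: group_hom_def group_hom_axioms_def group_VT group_BijGroup shift_group_simps)

context
  fixes n :: nat
begin

interpretation group "VT n" by (rule group_VT)
interpretation P: group_hom "VT n" "Sn n" "vt_pi n" by (rule group_hom_vt_pi)
interpretation S: group_hom "VT n" shift_group shift_hom by (rule group_hom_shift_hom)

lemma shift_hom_bij: "x \<in> carrier (VT n) \<Longrightarrow> bij (shift_hom x)"
  using S.hom_closed shift_group_simps(1) by blast

lemma shift_hom_mult:
  "x \<in> carrier (VT n) \<Longrightarrow> y \<in> carrier (VT n) \<Longrightarrow>
    shift_hom (x \<otimes>\<^bsub>VT n\<^esub> y) = shift_hom x \<circ> shift_hom y"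
  by (simp add: shift_group_simps(3) shift_hom_bij)

lemma vt_pi_mult:
  "x \<in> carrier (VT n) \<Longrightarrow> y \<in> carrier (VT n) \<Longrightarrow>
    vt_pi n (x \<otimes>\<^bsub>VT n\<^esub> y) = vt_pi n y \<circ> vt_pi n x"
  by simp

text \<open>Products of maps of the form \<open>(a, b, m) \<mapsto> (q(a), q(b), m + c(a, b))\<close> are again of this form.
  The permutation \<open>q\<close> is the inverse of \<open>\<pi>(x)\<close>, since permutations are multiplied from
  left to right in \<open>S\<^sub>n\<close> but composed from right to left as maps on triples.\<close>

lemma shift_hom_form:
  assumes "x \<in> carrier (VT n)"
  shows "\<exists>q c. (\<forall>a. vt_pi n x (q a) = a) \<and> (\<forall>a b m. shift_hom x (a, b, m) = (q a, q b, m + c a b))"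
  using assms
proof (induction rule: VT_induct)
  case one
  have "vt_pi n \<one>\<^bsub>VT n\<^esub> = id" using P.hom_one by simp
  moreover have "shift_hom \<one>\<^bsub>VT n\<^esub> = id" using S.hom_one shift_group_simps(2) by simp
  ultimately show ?case by (intro exI[of _ id] exI[of _ "\<lambda>_ _. 0"]) simp
next
  case (gen g x)
  then obtain q c where q: "\<And>a. vt_pi n x (q a) = a"
    and c: "\<And>a b m. shift_hom x (a, b, m) = (q a, q b, m + c a b)" by blast
  have g: "vt_word n [g] \<in> carrier (VT n)" using gen by simp
  have gg: "gen_perm g (gen_perm g a) = a" for a by (cases g) auto
  have "vt_pi n (vt_word n [g] \<otimes>\<^bsub>VT n\<^esub> x) (gen_perm g (q a)) = a" for a
    unfolding vt_pi_mult[OF g gen(2)] vt_pi_gen[OF gen(1)] by (simp add: gg q)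
  moreover have "shift_hom (vt_word n [g] \<otimes>\<^bsub>VT n\<^esub> x) (a, b, m)
      = (gen_perm g (q a), gen_perm g (q b), m + (c a b + pair_weight g (q a) (q b)))" for a b m
    unfolding shift_hom_mult[OF g gen(2)] shift_hom_gen[OF gen(1)] by (simp add: c pair_shift_apply)
  ultimately show ?case
    by (intro exI[of _ "\<lambda>a. gen_perm g (q a)"]
        exI[of _ "\<lambda>a b. c a b + pair_weight g (q a) (q b)"]) blast
qed

lemma PVT_normal: "PVT n \<lhd> VT n"
  unfolding PVT_def by (rule P.normal_kernel)

lemma PVT_iff: "x \<in> PVT n \<longleftrightarrow> x \<in> carrier (VT n) \<and> vt_pi n x = id"
  by (simp add: PVT_def kernel_def)

lemma Gamma2_normal: "Gamma2_PVT n \<lhd> VT n"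
  unfolding Gamma2_PVT_def by (rule derived_is_normal[OF PVT_normal])

lemma Gamma2_subset_PVT: "Gamma2_PVT n \<subseteq> PVT n"
  unfolding Gamma2_PVT_def by (rule derived_incl[OF subset_refl normal_imp_subgroup[OF PVT_normal]])

text \<open>A pure element has \<open>q = id\<close>, so it acts by a shift of the integer, and shifts commute.\<close>

lemma shift_hom_commute:
  assumes "x \<in> PVT n" "y \<in> PVT n"
  shows "shift_hom x \<circ> shift_hom y = shift_hom y \<circ> shift_hom x"
proof -
  have "\<exists>c. \<forall>a b m. shift_hom x (a, b, m) = (a, b, m + c a b)" if x: "x \<in> PVT n" for x
    using shift_hom_form[of x] x unfolding PVT_iff by fastforce
  from this[OF assms(1)] this[OF assms(2)] show ?thesis by (auto simp: fun_eq_iff)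
qed

lemma shift_hom_Gamma2:
  assumes "x \<in> Gamma2_PVT n"
  shows "shift_hom x = id"
proof -
  have "derived_set (VT n) (PVT n) \<subseteq> kernel (VT n) shift_group shift_hom"
  proof
    fix z assume "z \<in> derived_set (VT n) (PVT n)"
    then obtain x y where xy: "x \<in> PVT n" "y \<in> PVT n"
      and z: "z = x \<otimes>\<^bsub>VT n\<^esub> y \<otimes>\<^bsub>VT n\<^esub> inv\<^bsub>VT n\<^esub> x \<otimes>\<^bsub>VT n\<^esub> inv\<^bsub>VT n\<^esub> y" by auto
    have c: "x \<in> carrier (VT n)" "y \<in> carrier (VT n)" using xy by (auto simp: PVT_iff)
    have "shift_hom (x \<otimes>\<^bsub>VT n\<^esub> y) = shift_hom (y \<otimes>\<^bsub>VT n\<^esub> x)"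
      using shift_hom_commute[OF xy] c by (simp only: shift_hom_mult)
    moreover have "z = (x \<otimes>\<^bsub>VT n\<^esub> y) \<otimes>\<^bsub>VT n\<^esub> inv\<^bsub>VT n\<^esub> (y \<otimes>\<^bsub>VT n\<^esub> x)"
      using c by (simp add: z inv_mult_group m_assoc)
    ultimately have "shift_hom z = shift_hom ((y \<otimes>\<^bsub>VT n\<^esub> x) \<otimes>\<^bsub>VT n\<^esub> inv\<^bsub>VT n\<^esub> (y \<otimes>\<^bsub>VT n\<^esub> x))"
      using c shift_hom_mult by (metis m_closed inv_closed)
    then have "shift_hom z = \<one>\<^bsub>shift_group\<^esub>"
      using c S.hom_one by (simp only: r_inv m_closed)
    moreover have "z \<in> carrier (VT n)" using c z by simp
    ultimately show "z \<in> kernel (VT n) shift_group shift_hom" by (simp add: kernel_def)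
  qed
  then have "Gamma2_PVT n \<subseteq> kernel (VT n) shift_group shift_hom"
    unfolding Gamma2_PVT_def derived_def by (rule generate_subgroup_incl[OF _ S.subgroup_kernel])
  then show ?thesis using assms shift_group_simps(2) by (auto simp: kernel_def)
qed

lemma shift_hom_lam_pos:
  assumes "1 \<le> i" "i < j" "j \<le> n"
  shows "shift_hom (lam_pos n i j) (a, b, m)
    = (a, b, m + of_bool (a = j \<and> b = i) - of_bool (a = i \<and> b = j))"
proof -
  have "Suc i \<le> j" using assms by simp
  then show ?thesis using assms(3)
  proof (induction j arbitrary: a b m rule: dec_induct)
    case base
    have c: "sg n i \<in> carrier (VT n)" "rh n i \<in> carrier (VT n)" using base assms by auto
    have tr: "transpose i (i+1) x = i \<longleftrightarrow> x = i+1" "transpose i (i+1) x = i+1 \<longleftrightarrow> x = i" for x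
      by (auto simp: transpose_def)
    have "shift_hom (lam_pos n i (i+1)) = pair_shift (Sig i) \<circ> pair_shift (Rho i)"
      using base assms lam_pos_base[of i n] shift_hom_mult[OF c] shift_hom_gen[of "Sig i" n] shift_hom_gen[of "Rho i" n]
      by simp
    then show ?case using tr[of a] tr[of b] by (simp add: pair_shift_apply)
  next
    case (step j)
    have c: "lam_pos n i j \<in> carrier (VT n)" "rh n j \<in> carrier (VT n)" using step assms by auto
    have "shift_hom (lam_pos n i (Suc j))
      = pair_shift (Rho j) \<circ> (shift_hom (lam_pos n i j) \<circ> pair_shift (Rho j))"
      using lam_pos_step[of i j n] assms step c shift_hom_gen[of "Rho j" n]
      by (simp add: rho_conj_def shift_hom_mult del: S.hom_mult)
    moreover have "transpose j (Suc j) x = j \<longleftrightarrow> x = Suc j" "transpose j (Suc j) x = i \<longleftrightarrow> x = i" for x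
      using step by (auto simp: transpose_def)
    ultimately show ?case using step by (simp add: pair_shift_apply)
  qed
qed

lemma shift_hom_lam_VT:
  assumes "i \<in> {1..n}" "j \<in> {1..n}" "i \<noteq> j"
  shows "shift_hom (lam_VT n i j) (a, b, m)
    = (a, b, m + of_bool (a = j \<and> b = i) - of_bool (a = i \<and> b = j))"
proof (cases "i < j")
  case True
  then show ?thesis using assms by (simp add: lam_VT_def shift_hom_lam_pos)
next
  case False
  then have ji: "1 \<le> j" "j < i" "i \<le> n" using assms by auto
  have c: "lam_pos n j i \<in> carrier (VT n)" using ji by simp
  let ?w = "of_bool (a = j \<and> b = i) - of_bool (a = i \<and> b = j) :: int"
  \<comment> \<open>The shift is undone by feeding the inverse an already shifted triple.\<close>
  have "shift_hom (inv\<^bsub>VT n\<^esub> (lam_pos n j i)) \<circ> shift_hom (lam_pos n j i)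
      = shift_hom (inv\<^bsub>VT n\<^esub> (lam_pos n j i) \<otimes>\<^bsub>VT n\<^esub> lam_pos n j i)"
    using c by (simp only: shift_hom_mult inv_closed)
  also have "\<dots> = id" using c S.hom_one shift_group_simps(2) by simp
  finally have "shift_hom (inv\<^bsub>VT n\<^esub> (lam_pos n j i)) (shift_hom (lam_pos n j i) (a, b, m + ?w)) = (a, b, m + ?w)"
    by (simp add: fun_eq_iff)
  then show ?thesis using False by (simp add: lam_VT_def shift_hom_lam_pos[OF ji])
qed

lemma lam_VT_PVT:
  assumes "i \<in> {1..n}" "j \<in> {1..n}" "i \<noteq> j"
  shows "lam_VT n i j \<in> PVT n"
proof -
  have "lam_pos n i j \<in> PVT n" if "1 \<le> i" "i < j" "j \<le> n" for i j
  proof -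
    let ?w = "vt_word n (map Rho (rev [i+1..<j]))"
    have w: "?w \<in> carrier (VT n)" using that by (intro vt_word_closed) auto
    have "vt_word n [Sig i, Rho i] = sg n i \<otimes>\<^bsub>VT n\<^esub> rh n i" using that by (intro vt_word_Cons) auto
    then have "vt_word n [Sig i, Rho i] \<in> PVT n"
      using that vt_pi_gen[of "Sig i" n] vt_pi_gen[of "Rho i" n] by (simp add: PVT_iff)
    then show ?thesis
      unfolding lam_pos_def Let_def by (rule normal.inv_op_closed2[OF PVT_normal w])
  qed
  then show ?thesis
    using assms subgroup.m_inv_closed[OF normal_imp_subgroup[OF PVT_normal]] by (simp add: lam_VT_def)
qed

interpretation N: normal "Gamma2_PVT n" "VT n" by (rule Gamma2_normal)

text \<open>Elements with equal cosets act equally, and among the ordered pairs \<open>(a, b)\<close> only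
  \<open>(j, i)\<close> is shifted by \<open>+1\<close> under \<open>\<lambda>\<^bsub>i,j\<^esub>\<close>.\<close>

lemma lam_inj:
  assumes "i \<in> {1..n}" "j \<in> {1..n}" "i \<noteq> j" "k \<in> {1..n}" "l \<in> {1..n}" "k \<noteq> l"
    and "lam n i j = lam n k l"
  shows "i = k \<and> j = l"
proof -
  have "lam_VT n i j \<in> Gamma2_PVT n #>\<^bsub>VT n\<^esub> lam_VT n k l"
    using assms rcos_self[OF _ N.subgroup_axioms, of "lam_VT n i j"] unfolding lam_def by simp
  then obtain h where h: "h \<in> Gamma2_PVT n" "lam_VT n i j = h \<otimes>\<^bsub>VT n\<^esub> lam_VT n k l"
    unfolding r_coset_def by blast
  have "shift_hom (lam_VT n i j) = shift_hom (lam_VT n k l)"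
    unfolding h(2) using shift_hom_mult[of h "lam_VT n k l"] shift_hom_Gamma2[OF h(1)] N.mem_carrier[OF h(1)] assms
    by simp
  then have "shift_hom (lam_VT n i j) (j, i, 0) = shift_hom (lam_VT n k l) (j, i, 0)" by simp
  then show ?thesis
    using assms by (simp add: shift_hom_lam_VT) (auto simp: of_bool_def split: if_split_asm)
qed

end

section \<open>The quotient group and its action on the \<open>\<lambda>\<^bsub>i,j\<^esub>\<close>\<close>

definition vtq_class :: "nat \<Rightarrow> vgen gword set \<Rightarrow> vgen gword set set" where
  "vtq_class n x = Gamma2_PVT n #>\<^bsub>VT n\<^esub> x"

context
  fixes n :: nat
begin

interpretation group "VT n" by (rule group_VT)
interpretation N: normal "Gamma2_PVT n" "VT n" by (rule Gamma2_normal)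
interpretation P: group_hom "VT n" "Sn n" "vt_pi n" by (rule group_hom_vt_pi)

lemma group_VTQ: "group (VTQ n)"
  unfolding VTQ_def by (rule N.factorgroup_is_group)

interpretation Q: group "VTQ n" by (rule group_VTQ)

lemma vtq_class_hom: "vtq_class n \<in> hom (VT n) (VTQ n)"
  unfolding VTQ_def vtq_class_def by (rule N.r_coset_hom_Mod)

interpretation q: group_hom "VT n" "VTQ n" "vtq_class n"
  by unfold_locales (rule vtq_class_hom)

lemma carrier_VTQ: "carrier (VTQ n) = vtq_class n ` carrier (VT n)"
  by (simp add: VTQ_def carrier_FactGroup vtq_class_def[abs_def])

lemma carrier_PVTQ: "carrier (PVTQ n) = vtq_class n ` PVT n"
  by (simp add: PVTQ_def carrier_FactGroup vtq_class_def[abs_def] r_coset_def)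

text \<open>\<open>PVT\<^sub>n / \<Gamma>\<^sub>2(PVT\<^sub>n)\<close> is literally the subgroup of the quotient \<open>VT\<^sub>n / \<Gamma>\<^sub>2(PVT\<^sub>n)\<close> on its
  carrier, so facts transfer between the two structures.\<close>

lemma PVTQ_eq: "PVTQ n = (VTQ n)\<lparr>carrier := carrier (PVTQ n)\<rparr>"
  by (simp add: PVTQ_def VTQ_def FactGroup_def) (simp add: set_mult_def fun_eq_iff)

lemma comm_group_PVTQ: "comm_group (PVTQ n)"
  unfolding PVTQ_def Gamma2_PVT_def
  by (rule derived_quot_of_subgroup_is_comm_group[OF normal_imp_subgroup[OF PVT_normal]])

lemma PVTQ_mult: "x \<otimes>\<^bsub>PVTQ n\<^esub> y = x \<otimes>\<^bsub>VTQ n\<^esub> y"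
  by (subst PVTQ_eq) simp

lemma PVTQ_commute:
  "x \<in> carrier (PVTQ n) \<Longrightarrow> y \<in> carrier (PVTQ n) \<Longrightarrow> x \<otimes>\<^bsub>VTQ n\<^esub> y = y \<otimes>\<^bsub>VTQ n\<^esub> x"
  using comm_monoid.m_comm[OF comm_group.axioms(1)[OF comm_group_PVTQ]] by (simp add: PVTQ_mult)

lemma PVTQ_normal: "carrier (PVTQ n) \<lhd> VTQ n"
proof (rule Q.normal_invI)
  show "subgroup (carrier (PVTQ n)) (VTQ n)"
    unfolding carrier_PVTQ by (rule q.subgroup_img_is_subgroup[OF normal_imp_subgroup[OF PVT_normal]])
  fix x h assume "x \<in> carrier (VTQ n)" "h \<in> carrier (PVTQ n)"
  then obtain y k where y: "y \<in> carrier (VT n)" "x = vtq_class n y" and k: "k \<in> PVT n" "h = vtq_class n k"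
    unfolding carrier_VTQ carrier_PVTQ by blast
  have "x \<otimes>\<^bsub>VTQ n\<^esub> h \<otimes>\<^bsub>VTQ n\<^esub> inv\<^bsub>VTQ n\<^esub> x = vtq_class n (y \<otimes>\<^bsub>VT n\<^esub> k \<otimes>\<^bsub>VT n\<^esub> inv\<^bsub>VT n\<^esub> y)"
    using y k by (simp add: PVT_iff)
  moreover have "y \<otimes>\<^bsub>VT n\<^esub> k \<otimes>\<^bsub>VT n\<^esub> inv\<^bsub>VT n\<^esub> y \<in> PVT n"
    by (rule normal.inv_op_closed2[OF PVT_normal y(1) k(1)])
  ultimately show "x \<otimes>\<^bsub>VTQ n\<^esub> h \<otimes>\<^bsub>VTQ n\<^esub> inv\<^bsub>VTQ n\<^esub> x \<in> carrier (PVTQ n)"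
    unfolding carrier_PVTQ by simp
qed

lemma PVTQ_inv: "x \<in> carrier (PVTQ n) \<Longrightarrow> inv\<^bsub>PVTQ n\<^esub> x = inv\<^bsub>VTQ n\<^esub> x"
  by (subst PVTQ_eq) (rule Q.m_inv_consistent[OF normal_imp_subgroup[OF PVTQ_normal]])

lemma vt_pi_bar_class:
  assumes "x \<in> carrier (VT n)"
  shows "vt_pi_bar n (vtq_class n x) = vt_pi n x"
  unfolding vt_pi_bar_def
proof (rule the_elem_image_unique)
  show "vtq_class n x \<noteq> {}"
    using rcos_self[OF assms N.subgroup_axioms] unfolding vtq_class_def by blast
  fix y assume "y \<in> vtq_class n x"
  then obtain h where h: "h \<in> Gamma2_PVT n" "y = h \<otimes>\<^bsub>VT n\<^esub> x"
    unfolding vtq_class_def r_coset_def by blast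
  have "h \<in> PVT n" using h(1) Gamma2_subset_PVT by (rule subsetD[rotated])
  then have "vt_pi n h = id" by (simp add: PVT_iff)
  then show "vt_pi n y = vt_pi n x"
    unfolding h(2) vt_pi_mult[OF N.mem_carrier[OF h(1)] assms] by simp
qed

lemma lam_class: "lam n i j = vtq_class n (lam_VT n i j)"
  by (simp add: lam_def vtq_class_def)

lemma lam_PVTQ:
  "i \<in> {1..n} \<Longrightarrow> j \<in> {1..n} \<Longrightarrow> i \<noteq> j \<Longrightarrow> lam n i j \<in> carrier (PVTQ n)"
  unfolding lam_class carrier_PVTQ by (intro imageI lam_VT_PVT)

lemma lam_swap:
  assumes "i \<in> {1..n}" "j \<in> {1..n}" "i \<noteq> j"
  shows "lam n j i = inv\<^bsub>VTQ n\<^esub> (lam n i j)"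
  unfolding lam_class lam_VT_swap[OF assms] using assms by (intro q.hom_inv lam_VT_closed)

text \<open>For \<open>\<rho>\<^bsub>k\<^esub>\<close> this comes from \<open>VT\<^sub>n\<close>. Modulo \<open>\<Gamma>\<^sub>2\<close> the generator \<open>\<sigma>\<^bsub>k\<^esub>\<close> acts in the same
  way: \<open>\<sigma>\<^bsub>k\<^esub> = \<lambda>\<^bsub>k,k+1\<^esub> \<rho>\<^bsub>k\<^esub>\<close>, and \<open>\<lambda>\<^bsub>k,k+1\<^esub>\<close> commutes with every \<open>\<lambda>\<^bsub>i,j\<^esub>\<close>.\<close>

lemma conj_gen_lam:
  assumes g: "g \<in> vt_gens n" and ij: "i \<in> {1..n}" "j \<in> {1..n}" "i \<noteq> j"
  shows "vtq_class n (vt_word n [g]) \<otimes>\<^bsub>VTQ n\<^esub> lam n i j \<otimes>\<^bsub>VTQ n\<^esub> inv\<^bsub>VTQ n\<^esub> (vtq_class n (vt_word n [g]))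
    = lam n (gen_perm g i) (gen_perm g j)"
proof -
  have rho: "vtq_class n (rh n k) \<otimes>\<^bsub>VTQ n\<^esub> lam n i j \<otimes>\<^bsub>VTQ n\<^esub> inv\<^bsub>VTQ n\<^esub> (vtq_class n (rh n k))
      = lam n (transpose k (k+1) i) (transpose k (k+1) j)" if k: "1 \<le> k" "k < n" for k
  proof -
    have r: "rh n k \<in> carrier (VT n)" using k by simp
    have "inv\<^bsub>VT n\<^esub> (rh n k) = rh n k"
      using k vt_gen_square[of "Rho k" n] by (intro inv_equality) auto
    then have "vtq_class n (rh n k) \<otimes>\<^bsub>VTQ n\<^esub> lam n i j \<otimes>\<^bsub>VTQ n\<^esub> inv\<^bsub>VTQ n\<^esub> (vtq_class n (rh n k))
        = vtq_class n (rho_conj n k (lam_VT n i j))"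
      using r ij q.hom_inv[OF r] by (simp add: lam_class rho_conj_def Q.m_assoc)
    then show ?thesis using rho_conj_lam_VT[OF ij k] by (simp add: lam_class)
  qed
  show ?thesis
  proof (cases g)
    case (Rho k)
    then show ?thesis using rho g by simp
  next
    case (Sig k)
    then have k: "1 \<le> k" "k < n" using g by auto
    have car: "rh n k \<in> carrier (VT n)" "sg n k \<in> carrier (VT n)" using k by auto
    have "sg n k = lam_VT n k (k+1) \<otimes>\<^bsub>VT n\<^esub> rh n k"
      using k car lam_pos_base[of k n] vt_gen_square[of "Rho k" n] by (simp add: lam_VT_def m_assoc)
    then have s: "vtq_class n (sg n k) = lam n k (k+1) \<otimes>\<^bsub>VTQ n\<^esub> vtq_class n (rh n k)"
      using k car by (simp add: lam_class)
    let ?r = "vtq_class n (rh n k)" and ?l = "lam n k (k+1)"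
    have l: "?l \<in> carrier (PVTQ n)" using k by (intro lam_PVTQ) auto
    have t: "lam n (transpose k (k+1) i) (transpose k (k+1) j) \<in> carrier (PVTQ n)"
      using k ij by (intro lam_PVTQ) (auto simp: transpose_def)
    have sub: "x \<in> carrier (VTQ n)" if "x \<in> carrier (PVTQ n)" for x
      using that subgroup.mem_carrier[OF normal_imp_subgroup[OF PVTQ_normal]] by blast
    have cl: "?r \<in> carrier (VTQ n)" "?l \<in> carrier (VTQ n)" "lam n i j \<in> carrier (VTQ n)"
      using car l ij by (auto intro!: sub lam_PVTQ)
    have "vtq_class n (sg n k) \<otimes>\<^bsub>VTQ n\<^esub> lam n i j \<otimes>\<^bsub>VTQ n\<^esub> inv\<^bsub>VTQ n\<^esub> (vtq_class n (sg n k))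
        = ?l \<otimes>\<^bsub>VTQ n\<^esub> (?r \<otimes>\<^bsub>VTQ n\<^esub> lam n i j \<otimes>\<^bsub>VTQ n\<^esub> inv\<^bsub>VTQ n\<^esub> ?r) \<otimes>\<^bsub>VTQ n\<^esub> inv\<^bsub>VTQ n\<^esub> ?l"
      using cl unfolding s by (simp add: Q.inv_mult_group Q.m_assoc)
    also have "\<dots> = lam n (transpose k (k+1) i) (transpose k (k+1) j) \<otimes>\<^bsub>VTQ n\<^esub> ?l \<otimes>\<^bsub>VTQ n\<^esub> inv\<^bsub>VTQ n\<^esub> ?l"
      unfolding rho[OF k] by (subst PVTQ_commute[OF l t]) (rule HOL.refl)
    also have "\<dots> = lam n (transpose k (k+1) i) (transpose k (k+1) j)"
      using cl sub[OF t] by (simp add: Q.m_assoc)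
    finally show ?thesis using Sig by simp
  qed
qed

text \<open>The formula \<open>\<nu> \<lambda>\<^bsub>i,j\<^esub> \<nu>\<^sup>-\<^sup>1 = \<lambda>\<^bsub>\<theta>(i),\<theta>(j)\<^esub>\<close> with \<open>\<theta> = \<pi>(\<nu>)\<^sup>-\<^sup>1\<close>, stated without the
  inverse permutation so that the induction over generators goes through directly.\<close>

lemma conj_lam:
  assumes "x \<in> carrier (VT n)" "i \<in> {1..n}" "j \<in> {1..n}" "i \<noteq> j"
  shows "vtq_class n x \<otimes>\<^bsub>VTQ n\<^esub> lam n (vt_pi n x i) (vt_pi n x j) \<otimes>\<^bsub>VTQ n\<^esub> inv\<^bsub>VTQ n\<^esub> (vtq_class n x) = lam n i j"
  using assms
proof (induction arbitrary: i j rule: VT_induct)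
  case one
  have "lam n i j \<in> carrier (VTQ n)"
    using one subgroup.mem_carrier[OF normal_imp_subgroup[OF PVTQ_normal] lam_PVTQ] by blast
  then show ?case using P.hom_one q.hom_one by simp
next
  case (gen g x)
  let ?g = "vtq_class n (vt_word n [g])" and ?x = "vtq_class n x"
  let ?i = "gen_perm g i" and ?j = "gen_perm g j"
  have perm: "gen_perm g permutes {1..n}" by (rule gen_perm_permutes[OF gen(1)])
  have ij: "?i \<in> {1..n}" "?j \<in> {1..n}" "?i \<noteq> ?j"
    using gen.prems permutes_in_image[OF perm] inj_eq[OF permutes_inj[OF perm]] by auto
  have gg: "gen_perm g (gen_perm g a) = a" for a by (cases g) auto
  have pi: "vt_pi n (vt_word n [g] \<otimes>\<^bsub>VT n\<^esub> x) a = vt_pi n x (gen_perm g a)" for a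
    using gen(1,2) vt_pi_gen[OF gen(1)] by simp
  have xp: "vt_pi n x permutes {1..n}" using P.hom_closed[OF gen(2)] by simp
  have "lam n (vt_pi n x ?i) (vt_pi n x ?j) \<in> carrier (VTQ n)"
    using ij permutes_in_image[OF xp] inj_eq[OF permutes_inj[OF xp]]
    by (intro subgroup.mem_carrier[OF normal_imp_subgroup[OF PVTQ_normal]] lam_PVTQ) simp_all
  moreover have "?g \<in> carrier (VTQ n)" "?x \<in> carrier (VTQ n)" using gen(1,2) by simp_all
  moreover have "vtq_class n (vt_word n [g] \<otimes>\<^bsub>VT n\<^esub> x) = ?g \<otimes>\<^bsub>VTQ n\<^esub> ?x" using gen(1,2) by simp
  ultimately have "vtq_class n (vt_word n [g] \<otimes>\<^bsub>VT n\<^esub> x) \<otimes>\<^bsub>VTQ n\<^esub> lam n (vt_pi n x ?i) (vt_pi n x ?j)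
      \<otimes>\<^bsub>VTQ n\<^esub> inv\<^bsub>VTQ n\<^esub> (vtq_class n (vt_word n [g] \<otimes>\<^bsub>VT n\<^esub> x))
    = ?g \<otimes>\<^bsub>VTQ n\<^esub> (?x \<otimes>\<^bsub>VTQ n\<^esub> lam n (vt_pi n x ?i) (vt_pi n x ?j) \<otimes>\<^bsub>VTQ n\<^esub> inv\<^bsub>VTQ n\<^esub> ?x)
      \<otimes>\<^bsub>VTQ n\<^esub> inv\<^bsub>VTQ n\<^esub> ?g"
    by (simp add: Q.inv_mult_group Q.m_assoc)
  also have "\<dots> = lam n i j"
    unfolding gen.IH[OF ij] conj_gen_lam[OF gen(1) ij] by (simp add: gg)
  finally show ?case unfolding pi .
qed

end

section \<open>Orbits of elements and the conjugacy theorem\<close>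

lemma lam_orbit_ordered_orbit:
  assumes "\<theta> permutes {1..n}"
  shows "lam_orbit n \<theta> r s = (\<lambda>(i, j). lam n i j) ` ordered_orbit \<theta> r s"
  using Sn_int_pow_image[OF assms, of "\<lambda>p. lam n (p r) (p s)"]
  by (simp add: lam_orbit_def ordered_orbit_def image_image)

lemma inj_on_lam:
  "inj_on (\<lambda>(i, j). lam n i j) {(i, j). i \<in> {1..n} \<and> j \<in> {1..n} \<and> i \<noteq> j}"
proof (rule inj_onI, clarify)
  fix i j k l
  assume "i \<in> {1..n}" "j \<in> {1..n}" "i \<noteq> j" "k \<in> {1..n}" "l \<in> {1..n}" "k \<noteq> l"
    "lam n i j = lam n k l"
  from lam_inj[OF this] show "i = k \<and> j = l" .
qed

lemma ordered_orbit_range: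
  assumes "\<theta> permutes {1..n}" "r \<in> {1..n}" "s \<in> {1..n}" "r \<noteq> s"
  shows "ordered_orbit \<theta> r s \<subseteq> {(i, j). i \<in> {1..n} \<and> j \<in> {1..n} \<and> i \<noteq> j}"
proof
  fix p assume "p \<in> ordered_orbit \<theta> r s"
  then obtain i where p: "p = ((\<theta> ^^ i) r, (\<theta> ^^ i) s)" unfolding ordered_orbit_def by blast
  have perm: "(\<theta> ^^ i) permutes {1..n}" by (rule permutes_funpow[OF assms(1)])
  show "p \<in> {(i, j). i \<in> {1..n} \<and> j \<in> {1..n} \<and> i \<noteq> j}"
    unfolding p using assms(2-) permutes_in_image[OF perm] inj_eq[OF permutes_inj[OF perm]] by simp
qed

lemma card_lam_orbit:
  assumes "\<theta> permutes {1..n}" "r \<in> {1..n}" "s \<in> {1..n}" "r \<noteq> s"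
  shows "card (lam_orbit n \<theta> r s) = card (ordered_orbit \<theta> r s)"
  unfolding lam_orbit_ordered_orbit[OF assms(1)]
  by (rule card_image[OF inj_on_subset[OF inj_on_lam ordered_orbit_range[OF assms]]])

text \<open>Because the \<open>\<lambda>\<^bsub>i,j\<^esub>\<close> are distinct, membership and cardinality can be read off from the
  orbit of the index pair.\<close>

lemma inv_lam_in_lam_orbit_iff:
  assumes "\<theta> permutes {1..n}" "r \<in> {1..n}" "s \<in> {1..n}" "r \<noteq> s"
  shows "inv\<^bsub>VTQ n\<^esub> (lam n r s) \<in> lam_orbit n \<theta> r s \<longleftrightarrow> (s, r) \<in> ordered_orbit \<theta> r s"
proof -
  have "inv\<^bsub>VTQ n\<^esub> (lam n r s) = (\<lambda>(i, j). lam n i j) (s, r)"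
    using lam_swap[OF assms(2-)] by simp
  moreover have "(s, r) \<in> {(i, j). i \<in> {1..n} \<and> j \<in> {1..n} \<and> i \<noteq> j}" using assms by simp
  ultimately show ?thesis
    unfolding lam_orbit_ordered_orbit[OF assms(1)]
    by (simp only: inj_on_image_mem_iff[OF inj_on_lam _ ordered_orbit_range[OF assms]])
qed

text \<open>By injectivity of \<open>\<lambda>\<close> a transversal of elements is the same as a set of pairs that meets each
  orbit of unordered pairs exactly once.\<close>

lemma transversal_pairs:
  assumes perm: "\<theta> permutes {1..n}" and T: "lam_transversal n \<theta> T" and p: "p \<in> pairs n"
  shows "\<exists>!q. q \<in> {(r, s) \<in> pairs n. lam n r s \<in> T} \<and>
    (\<exists>i. {fst q, snd q} = (\<theta> ^^ i) ` {fst p, snd p})"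
proof -
  define X where "X = {(\<theta> [^]\<^bsub>Sn n\<^esub> k) ` {fst p, snd p} | k::int. True}"
  have X: "X = range (\<lambda>i. (\<theta> ^^ i) ` {fst p, snd p})"
    unfolding X_def using Sn_int_pow_image[OF perm, of "\<lambda>f. f ` {fst p, snd p}"] by simp
  have "(fst p, snd p) \<in> pairs n" using p by simp
  then have "X \<in> pair_orbits n \<theta>"
    unfolding X_def pair_orbits_def by (intro CollectI exI conjI) (rule HOL.refl)
  moreover have "\<forall>X \<in> pair_orbits n \<theta>.
      \<exists>!t. t \<in> T \<and> t \<in> {lam n r s | r s. (r, s) \<in> pairs n \<and> {r, s} \<in> X}"
    using T unfolding lam_transversal_def by (rule conjunct2)
  ultimately have "\<exists>!t. t \<in> T \<and> t \<in> {lam n r s | r s. (r, s) \<in> pairs n \<and> {r, s} \<in> X}"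
    by (rule bspec[rotated])
  then obtain t where t: "t \<in> T" "t \<in> {lam n r s | r s. (r, s) \<in> pairs n \<and> {r, s} \<in> X}"
    and uniq: "\<And>u. u \<in> T \<and> u \<in> {lam n r s | r s. (r, s) \<in> pairs n \<and> {r, s} \<in> X} \<Longrightarrow> u = t"
    by (elim ex1E conjE) (rule that, assumption+, erule allE, erule mp)
  from t(2) obtain r s where rs: "t = lam n r s" "(r, s) \<in> pairs n" "{r, s} \<in> X" by blast
  have X_iff: "A \<in> X \<longleftrightarrow> (\<exists>i. A = (\<theta> ^^ i) ` {fst p, snd p})" for A
    unfolding X image_iff by (simp only: UNIV_I bex_simps bex_UNIV)
  show ?thesis
  proof (rule ex1I[of _ "(r, s)"])
    show "(r, s) \<in> {(r, s) \<in> pairs n. lam n r s \<in> T} \<and>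
      (\<exists>i. {fst (r, s), snd (r, s)} = (\<theta> ^^ i) ` {fst p, snd p})"
      using t(1) rs(2,3) unfolding X_iff rs(1) by (simp only: mem_Collect_eq split_conv fst_conv snd_conv)
    fix q
    assume q: "q \<in> {(r, s) \<in> pairs n. lam n r s \<in> T} \<and> (\<exists>i. {fst q, snd q} = (\<theta> ^^ i) ` {fst p, snd p})"
    obtain r' s' where q': "q = (r', s')" by (cases q)
    have rs': "(r', s') \<in> pairs n" "lam n r' s' \<in> T" "{r', s'} \<in> X"
      using q unfolding q' X_iff by (simp_all only: mem_Collect_eq split_conv fst_conv snd_conv)
    have "lam n r' s' = lam n r s" unfolding rs(1)[symmetric] using rs' by (intro uniq) blast
    then have "r' = r \<and> s' = s"
      using rs(2) rs'(1) by (intro lam_inj[of r' n s' r s]) (simp_all add: pairs_def)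
    then show "q = (r, s)" unfolding q' by simp
  qed
qed

theorem theorem4p6:
  fixes n :: nat and \<sigma> :: "vgen gword set set" and \<theta> :: "nat \<Rightarrow> nat"
    and T :: "vgen gword set set set" and a b :: "nat \<Rightarrow> nat \<Rightarrow> int"
  assumes "n \<ge> 2"
    and "\<sigma> \<in> carrier (VTQ n)"
    and "\<theta> = inv\<^bsub>Sn n\<^esub> (vt_pi_bar n \<sigma>)"
    and "lam_transversal n \<theta> T"
    and "\<And>r s. \<lbrakk>(r, s) \<in> pairs n; lam n r s \<in> T; inv\<^bsub>VTQ n\<^esub> (lam n r s) \<notin> lam_orbit n \<theta> r s\<rbrakk>
      \<Longrightarrow> b r s = a r s + (\<Sum>i = 1..card (lam_orbit n \<theta> r s) - 1.
            (-1) ^ sign_exp ((\<theta> ^^ i) r) ((\<theta> ^^ i) s) * coeff_at a ((\<theta> ^^ i) r) ((\<theta> ^^ i) s))"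
    and "\<And>r s. \<lbrakk>(r, s) \<in> pairs n; lam n r s \<in> T; inv\<^bsub>VTQ n\<^esub> (lam n r s) \<in> lam_orbit n \<theta> r s\<rbrakk>
      \<Longrightarrow> b r s = a r s - (\<Sum>i = 1..card (lam_orbit n \<theta> r s) div 2 - 1.
            coeff_at a ((\<theta> ^^ i) r) ((\<theta> ^^ i) s))"
  shows "conjugate_in (VTQ n)
    (lam_prod n (pairs n) a \<otimes>\<^bsub>VTQ n\<^esub> \<sigma>)
    (lam_prod n {(r, s) \<in> pairs n. lam n r s \<in> T} b \<otimes>\<^bsub>VTQ n\<^esub> \<sigma>)"
proof -
  interpret Q: group "VTQ n" by (rule group_VTQ)
  interpret K: comm_group "PVTQ n" by (rule comm_group_PVTQ)
  interpret P: group_hom "VT n" "Sn n" "vt_pi n" by (rule group_hom_vt_pi)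
  let ?R = "{(r, s) \<in> pairs n. lam n r s \<in> T}"
  let ?D = "twisted_commutators (VTQ n) (carrier (PVTQ n)) \<sigma>"
  define p where "p x = ?D #>\<^bsub>PVTQ n\<^esub> x" for x
  obtain x where x: "x \<in> carrier (VT n)" "\<sigma> = vtq_class n x"
    using assms(2) unfolding carrier_VTQ by blast
  have \<theta>: "\<theta> = inv\<^bsub>Sn n\<^esub> (vt_pi n x)" using assms(3) vt_pi_bar_class[OF x(1)] x(2) by simp
  have pix: "vt_pi n x \<in> carrier (Sn n)" by (rule P.hom_closed[OF x(1)])
  have perm: "\<theta> permutes {1..n}" using P.H.inv_closed[OF pix] \<theta> by simp
  have pi_\<theta>: "vt_pi n x (\<theta> i) = i" for i
    using P.H.l_inv[OF pix] unfolding \<theta>[symmetric] by (simp add: fun_eq_iff)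
  note comm = PVTQ_commute
  have D: "subgroup ?D (PVTQ n)"
    using Q.subgroup_twisted_commutators[OF PVTQ_normal comm assms(2)]
    by (simp add: PVTQ_eq[of n, symmetric])
  \<comment> \<open>Modulo \<open>D\<close> conjugation by \<open>\<sigma>\<close> is trivial on \<open>K\<close>, so the class of
    \<open>\<lambda>\<^bsub>i,j\<^esub>\<close> is invariant under \<open>\<theta>\<close>.\<close>
  interpret D: normal ?D "PVTQ n" using D by (rule K.subgroup_imp_normal)
  let ?C = "PVTQ n Mod ?D"
  have C: "comm_group ?C" using D by (rule K.abelian_FactGroup)
  interpret C: comm_group ?C by (rule C)
  have p_hom: "p \<in> hom (PVTQ n) ?C" unfolding p_def[abs_def] by (rule D.r_coset_hom_Mod)
  interpret p: group_hom "PVTQ n" ?C p by unfold_locales (rule p_hom)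
  have lamK: "lam n i j \<in> carrier (PVTQ n)" if "i \<in> {1..n}" "j \<in> {1..n}" "i \<noteq> j" for i j
    using that by (rule lam_PVTQ)
  have p_swap: "p (lam n j i) = inv\<^bsub>?C\<^esub> (p (lam n i j))"
    if "i \<in> {1..n}" "j \<in> {1..n}" "i \<noteq> j" for i j
    unfolding lam_swap[OF that] PVTQ_inv[OF lamK[OF that], symmetric] by (rule p.hom_inv[OF lamK[OF that]])
  have \<theta>_range: "\<theta> i \<in> {1..n}" if "i \<in> {1..n}" for i using permutes_in_image[OF perm] that by blast
  have p_\<theta>: "p (lam n (\<theta> i) (\<theta> j)) = p (lam n i j)"
    if ij: "i \<in> {1..n}" "j \<in> {1..n}" "i \<noteq> j" for i j
  proof -
    have neq: "\<theta> i \<noteq> \<theta> j" using inj_eq[OF permutes_inj[OF perm]] ij by simp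
    let ?y = "lam n i j"
    have y: "?y \<in> carrier (PVTQ n)" "?y \<in> carrier (VTQ n)"
      using lamK[OF ij] subgroup.mem_carrier[OF normal_imp_subgroup[OF PVTQ_normal]] by auto
    have "lam n (\<theta> i) (\<theta> j) = \<sigma> \<otimes>\<^bsub>VTQ n\<^esub> ?y \<otimes>\<^bsub>VTQ n\<^esub> inv\<^bsub>VTQ n\<^esub> \<sigma>"
      using conj_lam[OF x(1) \<theta>_range[OF ij(1)] \<theta>_range[OF ij(2)] neq] by (simp add: pi_\<theta> x(2))
    also have "\<dots> = (\<sigma> \<otimes>\<^bsub>VTQ n\<^esub> ?y \<otimes>\<^bsub>VTQ n\<^esub> inv\<^bsub>VTQ n\<^esub> \<sigma> \<otimes>\<^bsub>VTQ n\<^esub> inv\<^bsub>VTQ n\<^esub> ?y) \<otimes>\<^bsub>PVTQ n\<^esub> ?y"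
      using y assms(2) by (simp add: PVTQ_mult Q.m_assoc)
    also have "\<dots> \<in> ?D #>\<^bsub>PVTQ n\<^esub> ?y"
      unfolding r_coset_def twisted_commutators_def using y(1) by blast
    finally show ?thesis unfolding p_def by (rule K.repr_independence[OF _ y(1) D, symmetric])
  qed
  have p_prod: "p (lam_prod n R c) = (\<Otimes>\<^bsub>?C\<^esub>q\<in>R. p (lam n (fst q) (snd q)) [^]\<^bsub>?C\<^esub> c (fst q) (snd q))"
    and prodK: "lam_prod n R c \<in> carrier (PVTQ n)" if "R \<subseteq> pairs n" for R and c :: "nat \<Rightarrow> nat \<Rightarrow> int"
  proof -
    have l: "lam n (fst q) (snd q) \<in> carrier (PVTQ n)" if "q \<in> R" for q
      using \<open>R \<subseteq> pairs n\<close> that by (intro lamK) (auto simp: pairs_def)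
    then show "lam_prod n R c \<in> carrier (PVTQ n)" unfolding lam_prod_def by (intro K.finprod_closed) auto
    have "p (lam_prod n R c) = (\<Otimes>\<^bsub>?C\<^esub>q\<in>R. p (lam n (fst q) (snd q) [^]\<^bsub>PVTQ n\<^esub> c (fst q) (snd q)))"
      unfolding lam_prod_def using l by (intro hom_finprod[OF K.comm_group_axioms C p_hom]) auto
    also have "\<dots> = (\<Otimes>\<^bsub>?C\<^esub>q\<in>R. p (lam n (fst q) (snd q)) [^]\<^bsub>?C\<^esub> c (fst q) (snd q))"
    proof (rule C.finprod_cong'[OF HOL.refl])
      show "p (lam n (fst q) (snd q) [^]\<^bsub>PVTQ n\<^esub> c (fst q) (snd q))
          = p (lam n (fst q) (snd q)) [^]\<^bsub>?C\<^esub> c (fst q) (snd q)" if "q \<in> R" for q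
        by (rule p.hom_int_pow[OF l[OF that]])
    qed (use l in \<open>auto intro: C.int_pow_closed p.hom_closed\<close>)
    finally show "p (lam_prod n R c) = (\<Otimes>\<^bsub>?C\<^esub>q\<in>R. p (lam n (fst q) (snd q)) [^]\<^bsub>?C\<^esub> c (fst q) (snd q))" .
  qed
  have R: "?R \<subseteq> pairs n" by blast
  have Rrs: "r \<in> {1..n}" "s \<in> {1..n}" "r \<noteq> s" if "(r, s) \<in> ?R" for r s
    using that by (auto simp: pairs_def)
  have "p (lam_prod n (pairs n) a) = p (lam_prod n ?R b)"
    unfolding p_prod[OF R] p_prod[OF subset_refl]
  proof (rule C.finprod_pairs_transversal[where M = "\<lambda>i j. p (lam n i j)", OF perm _ p_swap p_\<theta> R])
    show "p (lam n i j) \<in> carrier ?C" if "i \<in> {1..n}" "j \<in> {1..n}" "i \<noteq> j" for i j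
      by (rule p.hom_closed[OF lamK[OF that]])
    show "\<exists>!q. q \<in> ?R \<and> (\<exists>i. {fst q, snd q} = (\<theta> ^^ i) ` {fst p, snd p})" if "p \<in> pairs n" for p
      by (rule transversal_pairs[OF perm assms(4) that])
    fix r s assume rs: "(r, s) \<in> ?R"
    note range = Rrs[OF rs]
    note card = card_lam_orbit[OF perm range] and iff = inv_lam_in_lam_orbit_iff[OF perm range]
    have rs': "(r, s) \<in> pairs n" "lam n r s \<in> T" using rs by auto
    show "b r s = a r s + (\<Sum>i = 1..card (ordered_orbit \<theta> r s) - 1.
            (-1) ^ sign_exp ((\<theta> ^^ i) r) ((\<theta> ^^ i) s) * coeff_at a ((\<theta> ^^ i) r) ((\<theta> ^^ i) s))"
      if "(s, r) \<notin> ordered_orbit \<theta> r s"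
      using assms(5)[OF rs', unfolded iff, OF that] unfolding card .
    show "b r s = a r s - (\<Sum>i = 1..card (ordered_orbit \<theta> r s) div 2 - 1.
            coeff_at a ((\<theta> ^^ i) r) ((\<theta> ^^ i) s))"
      if "(s, r) \<in> ordered_orbit \<theta> r s"
      using assms(6)[OF rs', unfolded iff, OF that] unfolding card .
  qed
  moreover have "lam_prod n (pairs n) a \<in> p (lam_prod n (pairs n) a)"
    unfolding p_def by (rule K.rcos_self[OF prodK[OF subset_refl] D])
  ultimately have "lam_prod n (pairs n) a \<in> ?D #>\<^bsub>PVTQ n\<^esub> lam_prod n ?R b" by (simp add: p_def)
  then obtain y where y: "y \<in> carrier (PVTQ n)"
    and eq: "lam_prod n (pairs n) a
      = \<sigma> \<otimes>\<^bsub>VTQ n\<^esub> y \<otimes>\<^bsub>VTQ n\<^esub> inv\<^bsub>VTQ n\<^esub> \<sigma> \<otimes>\<^bsub>VTQ n\<^esub> inv\<^bsub>VTQ n\<^esub> y \<otimes>\<^bsub>VTQ n\<^esub> lam_prod n ?R b"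
    unfolding r_coset_def twisted_commutators_def by (auto simp: PVTQ_mult)
  show ?thesis
    unfolding eq by (rule Q.conjugate_in_twisted[OF PVTQ_normal comm assms(2) y prodK[OF R]])
qed

end
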